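(* Let $n>5$. (i) If $n$ is odd and $R$ is an $(n+2)$-dimensional solvable complex Leibniz algebra with nilradical isomorphic to $g^1_{(n,1)}$, then $R$ is isomorphic to the Lie algebra $R(g^1_{(n,1)},2)$ with basis $\{e_1,\dots,e_n,x,y\}$, in which $e_1,\dots,e_n$ have the brackets of $g^1_{(n,1)}$ and the remaining nonzero brackets are $[e_1,x]=-[x,e_1]=e_1$; $[e_i,x]=-[x,e_i]=(i-2)e_i$ for $2\le i\le n-1$; $[e_n,x]=-[x,e_n]=(n-4)e_n$; $[e_i,y]=-[y,e_i]=e_i$ for $2\le i\le n-1$; $[e_n,y]=-[y,e_n]=2e_n$. (ii) If $R$ is an $(n+2)$-dimensional solvable complex Leibniz algebra with nilradical isomorphic to $g^2_{(n,1)}$, then $R$ is isomorphic to the Lie algebra $R(g^2_{(n,1)},2)$ with basis $\{e_1,\dots,e_n,x,y\}$, in which $e_1,\dots,e_n$ have the brackets of $g^2_{(n,1)}$ and the remaining nonzero brackets are $[e_1,x]=-[x,e_1]=e_1$; $[e_i,x]=-[x,e_i]=(i-2)e_i$ for $2\le i\le n-1$; $[e_n,x]=-[x,e_n]=2e_n$; $[e_i,y]=-[y,e_i]=e_i$ for $2\le i\le n-1$. (In both algebras all brackets among $x,y$ and all brackets of basis elements not listed are zero.)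
   Context: A Leibniz algebra is a complex vector space with a bilinear bracket satisfying $[u,[v,w]]=[[u,v],w]-[[u,w],v]$; solvable, nilpotent and the nilradical (maximal nilpotent ideal) are defined as usual via derived and lower central series. $g^1_{(n,1)}$ ($n$ odd): Lie algebra with basis $e_1,\dots,e_n$ and nonzero brackets $[e_1,e_i]=-[e_i,e_1]=e_{i+1}$ ($2\le i\le n-2$), $[e_i,e_{n-i}]=-[e_{n-i},e_i]=(-1)^ie_n$ ($2\le i\le\frac{n-1}{2}$). $g^2_{(n,1)}$: Lie algebra with basis $e_1,\dots,e_n$ and nonzero brackets $[e_1,e_i]=-[e_i,e_1]=e_{i+1}$ ($2\le i\le n-2$), $[e_i,e_n]=-[e_n,e_i]=e_{i+2}$ ($2\le i\le n-3$). *)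

theory Defs
  imports Complex_Main "HOL-Library.Function_Algebras"
begin

definition leibniz_algebra ::
  "(complex \<Rightarrow> 'v::ab_group_add \<Rightarrow> 'v) \<Rightarrow> ('v \<Rightarrow> 'v \<Rightarrow> 'v) \<Rightarrow> bool" where
  "leibniz_algebra scale br \<longleftrightarrow>
     vector_space scale \<and>
     (\<forall>a u v w. br (scale a u + v) w = scale a (br u w) + br v w) \<and>
     (\<forall>a u v w. br u (scale a v + w) = scale a (br u v) + br u w) \<and>
     (\<forall>u v w. br u (br v w) = br (br u v) w - br (br u w) v)"

fun derived_series ::
  "(complex \<Rightarrow> 'v::ab_group_add \<Rightarrow> 'v) \<Rightarrow> ('v \<Rightarrow> 'v \<Rightarrow> 'v) \<Rightarrow> nat \<Rightarrow> 'v set" where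
  "derived_series scale br 0 = UNIV"
| "derived_series scale br (Suc k) =
     module.span scale {br a b | a b. a \<in> derived_series scale br k \<and> b \<in> derived_series scale br k}"

definition solvable_alg ::
  "(complex \<Rightarrow> 'v::ab_group_add \<Rightarrow> 'v) \<Rightarrow> ('v \<Rightarrow> 'v \<Rightarrow> 'v) \<Rightarrow> bool" where
  "solvable_alg scale br \<longleftrightarrow> (\<exists>k. derived_series scale br k = {0})"

fun lower_central ::
  "(complex \<Rightarrow> 'v::ab_group_add \<Rightarrow> 'v) \<Rightarrow> ('v \<Rightarrow> 'v \<Rightarrow> 'v) \<Rightarrow> 'v set \<Rightarrow> nat \<Rightarrow> 'v set" where
  "lower_central scale br I 0 = I"
| "lower_central scale br I (Suc k) =
     module.span scale {br a b | a b. a \<in> lower_central scale br I k \<and> b \<in> I}"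

definition nilpotent_on ::
  "(complex \<Rightarrow> 'v::ab_group_add \<Rightarrow> 'v) \<Rightarrow> ('v \<Rightarrow> 'v \<Rightarrow> 'v) \<Rightarrow> 'v set \<Rightarrow> bool" where
  "nilpotent_on scale br I \<longleftrightarrow> (\<exists>k. lower_central scale br I k = {0})"

definition is_ideal ::
  "(complex \<Rightarrow> 'v::ab_group_add \<Rightarrow> 'v) \<Rightarrow> ('v \<Rightarrow> 'v \<Rightarrow> 'v) \<Rightarrow> 'v set \<Rightarrow> bool" where
  "is_ideal scale br I \<longleftrightarrow> module.subspace scale I \<and> (\<forall>a\<in>I. \<forall>b. br a b \<in> I \<and> br b a \<in> I)"

definition is_nilradical ::
  "(complex \<Rightarrow> 'v::ab_group_add \<Rightarrow> 'v) \<Rightarrow> ('v \<Rightarrow> 'v \<Rightarrow> 'v) \<Rightarrow> 'v set \<Rightarrow> bool" where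
  "is_nilradical scale br N \<longleftrightarrow>
     is_ideal scale br N \<and> nilpotent_on scale br N \<and>
     (\<forall>M. is_ideal scale br M \<and> nilpotent_on scale br M \<and> N \<subseteq> M \<longrightarrow> M = N)"

definition alg_isomorphic ::
  "(complex \<Rightarrow> 'v::ab_group_add \<Rightarrow> 'v) \<Rightarrow> 'v set \<Rightarrow> ('v \<Rightarrow> 'v \<Rightarrow> 'v) \<Rightarrow>
   (complex \<Rightarrow> 'w::ab_group_add \<Rightarrow> 'w) \<Rightarrow> 'w set \<Rightarrow> ('w \<Rightarrow> 'w \<Rightarrow> 'w) \<Rightarrow> bool" where
  "alg_isomorphic s1 V b1 s2 W b2 \<longleftrightarrow>
     (\<exists>f. bij_betw f V W \<and>
          (\<forall>u\<in>V. \<forall>v\<in>V. f (u + v) = f u + f v) \<and>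
          (\<forall>a. \<forall>u\<in>V. f (s1 a u) = s2 a (f u)) \<and>
          (\<forall>u\<in>V. \<forall>v\<in>V. f (b1 u v) = b2 (f u) (f v)))"

text \<open>An algebra of dimension d with basis e_1, ..., e_d is modelled on coordinate vectors
  nat \<Rightarrow> complex supported in {1..d}; the basis vector e_i is the indicator of i, and
  the structure constants c i j k give [e_i, e_j] = \<Sum>_k c i j k e_k.\<close>

definition coords :: "nat \<Rightarrow> (nat \<Rightarrow> complex) set" where
  "coords d = {u. \<forall>k. k \<notin> {1..d} \<longrightarrow> u k = 0}"

definition cscale :: "complex \<Rightarrow> (nat \<Rightarrow> complex) \<Rightarrow> (nat \<Rightarrow> complex)" where
  "cscale a u = (\<lambda>k. a * u k)"

definition sc_br :: "nat \<Rightarrow> (nat \<Rightarrow> nat \<Rightarrow> nat \<Rightarrow> complex) \<Rightarrow>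
    (nat \<Rightarrow> complex) \<Rightarrow> (nat \<Rightarrow> complex) \<Rightarrow> (nat \<Rightarrow> complex)" where
  "sc_br d c u v = (\<lambda>k. if k \<in> {1..d} then (\<Sum>i\<in>{1..d}. \<Sum>j\<in>{1..d}. u i * v j * c i j k) else 0)"

text \<open>g^1_(n,1) (n odd): [e_1,e_i] = -[e_i,e_1] = e_(i+1) (2 \<le> i \<le> n-2),
  [e_i,e_(n-i)] = -[e_(n-i),e_i] = (-1)^i e_n (2 \<le> i \<le> (n-1)/2).\<close>

definition g1 :: "nat \<Rightarrow> nat \<Rightarrow> nat \<Rightarrow> nat \<Rightarrow> complex" where
  "g1 n i j k =
     (if i = 1 \<and> 2 \<le> j \<and> j \<le> n - 2 \<and> k = j + 1 then 1 else 0)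
   + (if j = 1 \<and> 2 \<le> i \<and> i \<le> n - 2 \<and> k = i + 1 then -1 else 0)
   + (if 2 \<le> i \<and> i \<le> (n - 1) div 2 \<and> j = n - i \<and> k = n then (-1) ^ i else 0)
   + (if 2 \<le> j \<and> j \<le> (n - 1) div 2 \<and> i = n - j \<and> k = n then - ((-1) ^ j) else 0)"

definition g2 :: "nat \<Rightarrow> nat \<Rightarrow> nat \<Rightarrow> nat \<Rightarrow> complex" where
  "g2 n i j k =
     (if i = 1 \<and> 2 \<le> j \<and> j \<le> n - 2 \<and> k = j + 1 then 1 else 0)
   + (if j = 1 \<and> 2 \<le> i \<and> i \<le> n - 2 \<and> k = i + 1 then -1 else 0)
   + (if 2 \<le> i \<and> i \<le> n - 3 \<and> j = n \<and> k = i + 2 then 1 else 0)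
   + (if 2 \<le> j \<and> j \<le> n - 3 \<and> i = n \<and> k = j + 2 then -1 else 0)"

text \<open>Extension of an n-dimensional algebra with structure constants g by two elements
  x = e_(n+1), y = e_(n+2) acting diagonally: [e_i,x] = -[x,e_i] = \<alpha> i e_i,
  [e_i,y] = -[y,e_i] = \<beta> i e_i (1 \<le> i \<le> n); [x,y] etc. are zero.\<close>

definition ext2 :: "nat \<Rightarrow> (nat \<Rightarrow> nat \<Rightarrow> nat \<Rightarrow> complex) \<Rightarrow> (nat \<Rightarrow> complex) \<Rightarrow> (nat \<Rightarrow> complex)
    \<Rightarrow> nat \<Rightarrow> nat \<Rightarrow> nat \<Rightarrow> complex" where
  "ext2 n g \<alpha> \<beta> i j k =
     (if 1 \<le> i \<and> i \<le> n \<and> 1 \<le> j \<and> j \<le> n then g i j k else 0)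
   + (if 1 \<le> i \<and> i \<le> n \<and> j = n + 1 \<and> k = i then \<alpha> i else 0)
   + (if 1 \<le> j \<and> j \<le> n \<and> i = n + 1 \<and> k = j then - \<alpha> j else 0)
   + (if 1 \<le> i \<and> i \<le> n \<and> j = n + 2 \<and> k = i then \<beta> i else 0)
   + (if 1 \<le> j \<and> j \<le> n \<and> i = n + 2 \<and> k = j then - \<beta> j else 0)"

definition alpha1 :: "nat \<Rightarrow> nat \<Rightarrow> complex" where
  "alpha1 n i = (if i = 1 then 1 else if i = n then of_nat n - 4 else of_nat i - 2)"

definition beta1 :: "nat \<Rightarrow> nat \<Rightarrow> complex" where
  "beta1 n i = (if i = 1 then 0 else if i = n then 2 else 1)"

definition R1 :: "nat \<Rightarrow> nat \<Rightarrow> nat \<Rightarrow> nat \<Rightarrow> complex" where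
  "R1 n = ext2 n (g1 n) (alpha1 n) (beta1 n)"

definition alpha2 :: "nat \<Rightarrow> nat \<Rightarrow> complex" where
  "alpha2 n i = (if i = 1 then 1 else if i = n then 2 else of_nat i - 2)"

definition beta2 :: "nat \<Rightarrow> nat \<Rightarrow> complex" where
  "beta2 n i = (if i = 1 then 0 else if i = n then 0 else 1)"

definition R2 :: "nat \<Rightarrow> nat \<Rightarrow> nat \<Rightarrow> nat \<Rightarrow> complex" where
  "R2 n = ext2 n (g2 n) (alpha2 n) (beta2 n)"

end

(* An extension R is governed by the linear forms lam and mu reading off the diagonal of the derivation
   that r induces on the nilradical N; every derivation of N is triangular with weights p k * lam + q k * mu.
   Hence [R, R] lies in K = ker lam \<inter> ker mu, and if K were larger than N, then N together with one
   more element of K would be a nilpotent ideal (solvability makes it an ideal). So K = N and some h has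
   lam h = 1, mu h = n, which makes the weights on N positive and distinct. Right-annihilating elements
   vanish because h acts invertibly on the centre of N, so R is a Lie algebra; the centralizer of h
   is an abelian complement of N, and the h-eigenvectors of N, normalised to leading coefficient 1, have the
   structure constants of N since these are graded by the h-weights. *)
theory Submission
  imports Defs
begin

text \<open>The obstacle is that \<open>R\<close> is at first only a Leibniz algebra: the identity
  makes the right multiplications derivations, but says nothing of the kind about the left ones. The
  whole weight analysis therefore runs on right multiplications, and antisymmetry can be proved only
  once \<open>h\<close> is available. The value \<open>mu h = n\<close> comes from reading a pair of
  weights as two digits in base \<open>n\<close>. In both families \<open>p k < n\<close> on the
  index range and the pairs \<open>(p k, q k)\<close> are pairwise distinct and nonzero, so the
  numbers \<open>p k + n * q k\<close> are distinct and positive. The same numbers give the order in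
  which derivations are triangular. The order of the indices would not do for g^2: there [e_n, e_2]
  = -e_4, so e_n must precede e_4, and its weight 2 puts it between e_1 and e_2. Distinct weights
  make the eigenspaces of \<open>h\<close> on \<open>N\<close> one-dimensional. An eigenvector in
  \<open>N\<close> is therefore zero as soon as one particular coordinate vanishes, and this test
  proves the bracket relations of the new basis.\<close>

section \<open>Coordinate vectors and derivations in coordinates\<close>

definition unit_vec :: "nat \<Rightarrow> nat \<Rightarrow> complex" where
  "unit_vec k = (\<lambda>j. if j = k then 1 else 0)"

lemma unit_vec_apply [simp]: "unit_vec k j = (if j = k then 1 else 0)"
  by (simp add: unit_vec_def)

definition matrix_of :: "((nat \<Rightarrow> complex) \<Rightarrow> nat \<Rightarrow> complex) \<Rightarrow> nat \<Rightarrow> nat \<Rightarrow> complex" where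
  "matrix_of D j = D (unit_vec j)"

lemma unit_vec_in_coords: "k \<in> {1..d} \<Longrightarrow> unit_vec k \<in> coords d"
  by (auto simp: coords_def)

lemma coords_eqI:
  assumes "u \<in> coords d" "v \<in> coords d" "\<And>k. k \<in> {1..d} \<Longrightarrow> u k = v k"
  shows "u = v"
proof
  fix k show "u k = v k"
    using assms by (cases "k \<in> {1..d}") (auto simp: coords_def)
qed

lemma zero_in_coords: "0 \<in> coords d"
  by (simp add: coords_def)

lemma sc_br_in_coords: "sc_br d c u v \<in> coords d"
  by (auto simp: coords_def sc_br_def)

lemma sc_br_zero_left [simp]: "sc_br d c 0 v = 0"
  by (auto simp: sc_br_def fun_eq_iff)

lemma sc_br_zero_right [simp]: "sc_br d c v 0 = 0"
  by (auto simp: sc_br_def fun_eq_iff)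

lemma sc_br_swap:
  assumes "\<And>i j k. c i j k = - c j i k"
  shows "sc_br d c u v = - sc_br d c v u"
proof
  fix k
  have "(\<Sum>i\<in>{1..d}. \<Sum>j\<in>{1..d}. u i * v j * c i j k)
      = (\<Sum>j\<in>{1..d}. \<Sum>i\<in>{1..d}. u i * v j * c i j k)"
    by (rule sum.swap)
  also have "\<dots> = - (\<Sum>j\<in>{1..d}. \<Sum>i\<in>{1..d}. v j * u i * c j i k)"
    unfolding sum_negf[symmetric]
    by (intro sum.cong refl) (subst assms, simp)
  finally show "sc_br d c u v k = (- sc_br d c v u) k"
    by (simp add: sc_br_def)
qed

definition is_derivation ::
  "nat \<Rightarrow> (nat \<Rightarrow> nat \<Rightarrow> nat \<Rightarrow> complex) \<Rightarrow> ((nat \<Rightarrow> complex) \<Rightarrow> nat \<Rightarrow> complex) \<Rightarrow> bool" where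
  "is_derivation d c D \<longleftrightarrow> (\<forall>u\<in>coords d. D u \<in> coords d) \<and>
     (\<forall>u\<in>coords d. \<forall>v\<in>coords d. D (sc_br d c u v) = sc_br d c (D u) v + sc_br d c u (D v))"

text \<open>Every tabulated bracket of basis vectors becomes a family of linear equations between
  the matrix entries of \<open>D\<close>, one for each coordinate \<open>k\<close>.\<close>

lemma derivation_unit_vec:
  assumes D: "is_derivation d c D" and ij: "i \<in> {1..d}" "j \<in> {1..d}"
  shows "sc_br d c (unit_vec i) (unit_vec j) = unit_vec r \<Longrightarrow> matrix_of D r k =
      sc_br d c (matrix_of D i) (unit_vec j) k + sc_br d c (unit_vec i) (matrix_of D j) k"
    and "sc_br d c (unit_vec i) (unit_vec j) = 0 \<Longrightarrow>
      sc_br d c (matrix_of D i) (unit_vec j) k + sc_br d c (unit_vec i) (matrix_of D j) k = 0"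
proof -
  have DD: "D (sc_br d c u v) = sc_br d c (D u) v + sc_br d c u (D v)"
    if "u \<in> coords d" "v \<in> coords d" for u v
    using D that by (simp add: is_derivation_def)
  have eq: "D (sc_br d c (unit_vec i) (unit_vec j)) k =
      sc_br d c (matrix_of D i) (unit_vec j) k + sc_br d c (unit_vec i) (matrix_of D j) k"
    using DD[OF unit_vec_in_coords[OF ij(1)] unit_vec_in_coords[OF ij(2)]] by (simp add: matrix_of_def)
  {
    assume "sc_br d c (unit_vec i) (unit_vec j) = unit_vec r"
    from eq[unfolded this] show "matrix_of D r k =
        sc_br d c (matrix_of D i) (unit_vec j) k + sc_br d c (unit_vec i) (matrix_of D j) k"
      by (simp only: matrix_of_def)
  }
  assume s: "sc_br d c (unit_vec i) (unit_vec j) = 0"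
  \<comment> \<open>Linearity is not part of \<open>is_derivation\<close>; the value at 0 comes from
    the product rule for the pair (0, 0).\<close>
  have "D 0 = 0" using DD[OF zero_in_coords zero_in_coords] by simp
  with eq[unfolded s] show
    "sc_br d c (matrix_of D i) (unit_vec j) k + sc_br d c (unit_vec i) (matrix_of D j) k = 0"
    by simp
qed

section \<open>Bracket calculus in a Leibniz algebra\<close>

locale leibniz = vector_space scale
  for scale :: "complex \<Rightarrow> 'v::ab_group_add \<Rightarrow> 'v" +
  fixes br :: "'v \<Rightarrow> 'v \<Rightarrow> 'v"
  assumes br_left: "br (scale a u + v) w = scale a (br u w) + br v w"
    and br_right: "br u (scale a v + w) = scale a (br u v) + br u w"
    and br_br: "br u (br v w) = br (br u v) w - br (br u w) v"
begin

lemma br_add_left: "br (u + v) w = br u w + br v w"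
  using br_left[of 1 u v w] by simp

lemma br_add_right: "br u (v + w) = br u v + br u w"
  using br_right[of u 1 v w] by simp

lemma br_zero_left [simp]: "br 0 w = 0"
  using br_add_left[of 0 0 w] by simp

lemma br_zero_right [simp]: "br w 0 = 0"
  using br_add_right[of w 0 0] by simp

lemma br_scale_left: "br (scale a u) w = scale a (br u w)"
  using br_left[of a u 0 w] by simp

lemma br_scale_right: "br u (scale a w) = scale a (br u w)"
  using br_right[of u a w 0] by simp

lemma br_diff_left: "br (u - v) w = br u w - br v w"
  using br_add_left[of "u - v" v w] by simp

lemma br_diff_right: "br u (v - w) = br u v - br u w"
  using br_add_right[of u "v - w" w] by simp

lemma br_sum_left: "br (sum f A) w = (\<Sum>i\<in>A. br (f i) w)"
  by (induction A rule: infinite_finite_induct) (auto simp: br_add_left)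

lemma br_sum_right: "br w (sum f A) = (\<Sum>i\<in>A. br w (f i))"
  by (induction A rule: infinite_finite_induct) (auto simp: br_add_right)

text \<open>The Leibniz identity rearranged: right multiplication by \<open>w\<close> is a
  derivation.\<close>

lemma br_derivation: "br (br u v) w = br (br u w) v + br u (br v w)"
  using br_br[of u v w] by simp

text \<open>The isomorphism is the coordinate map, obtained as the inverse of the linear combination
  map \<open>G\<close>. Bilinearity reduces the bracket to the basis, and reordering a triple sum
  yields \<open>sc_br\<close>.\<close>

lemma alg_isomorphic_of_basis:
  fixes B :: "nat \<Rightarrow> 'v"
  assumes indep: "\<And>a. (\<Sum>k\<in>{1..d}. scale (a k) (B k)) = 0 \<Longrightarrow> \<forall>k\<in>{1..d}. a k = 0"
    and spanning: "\<And>u. \<exists>a. u = (\<Sum>k\<in>{1..d}. scale (a k) (B k))"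
    and br_basis: "\<And>i j. i \<in> {1..d} \<Longrightarrow> j \<in> {1..d} \<Longrightarrow>
      br (B i) (B j) = (\<Sum>k\<in>{1..d}. scale (c i j k) (B k))"
  shows "alg_isomorphic scale UNIV br cscale (coords d) (sc_br d c)"
proof -
  define G where "G a = (\<Sum>k\<in>{1..d}. scale (a k) (B k))" for a :: "nat \<Rightarrow> complex"
  have G_add: "G (\<lambda>k. a k + b k) = G a + G b" for a b
    by (simp add: G_def scale_left_distrib sum.distrib)
  have G_scale: "G (\<lambda>k. x * a k) = scale x (G a)" for x a
    by (simp add: G_def scale_sum_right)
  have inj: "inj_on G (coords d)"
  proof (rule inj_onI)
    fix a b assume ab: "a \<in> coords d" "b \<in> coords d" "G a = G b"
    have "G (\<lambda>k. a k + (-1) * b k) = 0"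
      using ab(3) by (simp only: G_add G_scale) simp
    then have "\<forall>k\<in>{1..d}. a k + (-1) * b k = 0"
      unfolding G_def by (rule indep)
    with ab show "a = b" by (intro coords_eqI) auto
  qed
  have surj: "G ` coords d = UNIV"
  proof -
    have "u \<in> G ` coords d" for u
    proof -
      obtain a where a: "u = (\<Sum>k\<in>{1..d}. scale (a k) (B k))" using spanning by blast
      \<comment> \<open>Resetting the coefficients to 0 outside the index range puts them into
        \<open>coords d\<close>.\<close>
      have "u = G (\<lambda>k. if k \<in> {1..d} then a k else 0)"
        unfolding a G_def by (intro sum.cong) auto
      then show ?thesis by (auto simp: coords_def)
    qed
    then show ?thesis by blast
  qed
  have bij: "bij_betw G (coords d) UNIV"
    using inj surj by (simp add: bij_betw_def)
  define F where "F = inv_into (coords d) G"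
  have bijF: "bij_betw F UNIV (coords d)"
    unfolding F_def by (rule bij_betw_inv_into[OF bij])
  have GF: "G (F u) = u" for u
    using surj by (simp add: F_def f_inv_into_f)
  have Fc: "F u \<in> coords d" for u
    using bijF by (auto simp: bij_betw_def)
  have FG: "F (G a) = a" if "a \<in> coords d" for a
    unfolding F_def using inj that by simp
  have "F (u + v) = F u + F v" for u v
  proof -
    have "u + v = G (\<lambda>k. F u k + F v k)" by (simp add: G_add GF)
    moreover have "(\<lambda>k. F u k + F v k) \<in> coords d" using Fc[of u] Fc[of v] by (simp add: coords_def)
    ultimately show ?thesis using FG by (simp add: plus_fun_def)
  qed
  moreover have "F (scale x u) = cscale x (F u)" for x u
  proof -
    have "scale x u = G (\<lambda>k. x * F u k)" by (simp add: G_scale GF)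
    moreover have "(\<lambda>k. x * F u k) \<in> coords d" using Fc[of u] by (simp add: coords_def)
    ultimately show ?thesis using FG by (simp add: cscale_def)
  qed
  moreover have "F (br u v) = sc_br d c (F u) (F v)" for u v
  proof -
    let ?I = "{1..d}"
    have "br u v = br (G (F u)) (G (F v))" by (simp add: GF)
    also have "\<dots> = (\<Sum>i\<in>?I. \<Sum>j\<in>?I. scale (F u i * F v j) (br (B i) (B j)))"
      unfolding G_def br_sum_left br_scale_left
      by (simp add: br_sum_right br_scale_right scale_sum_right)
    also have "\<dots> = (\<Sum>i\<in>?I. \<Sum>j\<in>?I. \<Sum>k\<in>?I. scale (F u i * F v j * c i j k) (B k))"
      by (simp add: br_basis scale_sum_right)
    also have "\<dots> = (\<Sum>i\<in>?I. \<Sum>k\<in>?I. \<Sum>j\<in>?I. scale (F u i * F v j * c i j k) (B k))"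
      by (rule sum.cong[OF refl], rule sum.swap)
    also have "\<dots> = (\<Sum>k\<in>?I. \<Sum>i\<in>?I. \<Sum>j\<in>?I. scale (F u i * F v j * c i j k) (B k))"
      by (rule sum.swap)
    also have "\<dots> = G (sc_br d c (F u) (F v))"
      by (simp add: G_def sc_br_def scale_sum_left)
    finally show ?thesis using FG[OF sc_br_in_coords] by metis
  qed
  ultimately show ?thesis
    unfolding alg_isomorphic_def using bijF by blast
qed

end

lemma leibniz_algebra_imp_leibniz: "leibniz_algebra scale br \<Longrightarrow> leibniz scale br"
  by (simp add: leibniz_algebra_def leibniz_def leibniz_axioms_def)

section \<open>Interface for the nilradical and its extension\<close>

text \<open>\<open>p k\<close> and \<open>q k\<close> are the weights of the basis vector \<open>k\<close> under the two generators of a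
  torus of derivations, and \<open>rk k\<close> is its weight under the element (1, n) of that torus.\<close>

locale rigid_nilradical =
  fixes n :: nat and g :: "nat \<Rightarrow> nat \<Rightarrow> nat \<Rightarrow> complex" and p q :: "nat \<Rightarrow> nat" and l m :: nat
    and rk :: "nat \<Rightarrow> nat"
  defines "rk k \<equiv> p k + n * q k"
  assumes anti: "g i j k = - g j i k"
    and closed: "\<lbrakk>i \<in> {1..n}; j \<in> {1..n}; g i j k \<noteq> 0\<rbrakk> \<Longrightarrow> k \<in> {1..n}"
    and homog: "\<lbrakk>i \<in> {1..n}; j \<in> {1..n}; k \<in> {1..n}; g i j k \<noteq> 0\<rbrakk> \<Longrightarrow> rk k = rk i + rk j"
    and rk_inj: "inj_on rk {1..n}"
    and rk_pos: "k \<in> {1..n} \<Longrightarrow> 0 < rk k"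
    and l: "l \<in> {1..n}" "p l = 1" "q l = 0"
    and m: "m \<in> {1..n}" "p m = 0" "q m = 1"
    and center: "\<lbrakk>z \<in> coords n; \<And>v. v \<in> coords n \<Longrightarrow> sc_br n g v z = 0\<rbrakk>
      \<Longrightarrow> \<exists>u\<in>coords n. \<exists>v\<in>coords n. z = sc_br n g u v"
    and derivation_triangular: "\<lbrakk>is_derivation n g D; j \<in> {1..n}; k \<in> {1..n}; rk k < rk j\<rbrakk>
      \<Longrightarrow> matrix_of D j k = 0"
    and derivation_diagonal: "\<lbrakk>is_derivation n g D; k \<in> {1..n}\<rbrakk>
      \<Longrightarrow> matrix_of D k k = of_nat (p k) * matrix_of D l l + of_nat (q k) * matrix_of D m m"

text \<open>The given isomorphism appears as \<open>\<phi>\<close>, whose laws hold on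
  \<open>N\<close> only; hence the membership side conditions throughout.\<close>

locale rigid_extension = leibniz scale br + rigid_nilradical n g p q l m rk
  for scale :: "complex \<Rightarrow> 'v::ab_group_add \<Rightarrow> 'v" and br
    and n g p q l m and rk +
  fixes N :: "'v set" and \<phi> :: "'v \<Rightarrow> nat \<Rightarrow> complex"
  assumes dim_UNIV: "dim (UNIV :: 'v set) = n + 2"
    and solvable: "solvable_alg scale br"
    and nilradical: "is_nilradical scale br N"
    and phi_bij: "bij_betw \<phi> N (coords n)"
    and phi_add: "\<lbrakk>u \<in> N; v \<in> N\<rbrakk> \<Longrightarrow> \<phi> (u + v) = \<phi> u + \<phi> v"
    and phi_scale: "u \<in> N \<Longrightarrow> \<phi> (scale a u) = cscale a (\<phi> u)"
    and phi_br: "\<lbrakk>u \<in> N; v \<in> N\<rbrakk> \<Longrightarrow> \<phi> (br u v) = sc_br n g (\<phi> u) (\<phi> v)"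
begin

declare atLeastAtMost_iff [simp del] One_nat_def [simp del]

abbreviation "I \<equiv> {1..n}"

lemma N_subspace: "subspace N"
  using nilradical by (simp add: is_nilradical_def is_ideal_def)

lemma N_br_left: "u \<in> N \<Longrightarrow> br u r \<in> N"
  using nilradical by (simp add: is_nilradical_def is_ideal_def)

lemma N_br_right: "u \<in> N \<Longrightarrow> br r u \<in> N"
  using nilradical by (simp add: is_nilradical_def is_ideal_def)

lemmas N_closed = subspace_0[OF N_subspace] subspace_add[OF N_subspace] subspace_diff[OF N_subspace]
  subspace_scale[OF N_subspace] subspace_neg[OF N_subspace] subspace_sum[OF N_subspace]
  N_br_left N_br_right

lemma phi_coords: "u \<in> N \<Longrightarrow> \<phi> u \<in> coords n"
  using phi_bij by (auto simp: bij_betw_def)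

lemma phi_add_apply: "\<lbrakk>u \<in> N; v \<in> N\<rbrakk> \<Longrightarrow> \<phi> (u + v) k = \<phi> u k + \<phi> v k"
  by (simp add: phi_add)

lemma phi_scale_apply: "u \<in> N \<Longrightarrow> \<phi> (scale a u) k = a * \<phi> u k"
  by (simp add: phi_scale cscale_def)

lemma phi_zero_apply: "\<phi> 0 k = 0"
  using phi_scale_apply[of 0 0] N_closed(1) by simp

lemma phi_diff_apply: "\<lbrakk>u \<in> N; v \<in> N\<rbrakk> \<Longrightarrow> \<phi> (u - v) k = \<phi> u k - \<phi> v k"
  using phi_add_apply[of "u - v" v] by (simp add: N_closed)

lemma phi_sum_apply: "\<lbrakk>\<And>i. i \<in> A \<Longrightarrow> f i \<in> N\<rbrakk> \<Longrightarrow> \<phi> (sum f A) k = (\<Sum>i\<in>A. \<phi> (f i) k)"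
  by (induction A rule: infinite_finite_induct) (auto simp: phi_zero_apply phi_add_apply N_closed)

lemmas phi_simps = phi_add_apply phi_scale_apply phi_zero_apply phi_diff_apply

lemma phi_eqI:
  assumes "u \<in> N" "v \<in> N" "\<And>k. k \<in> I \<Longrightarrow> \<phi> u k = \<phi> v k"
  shows "u = v"
proof -
  have "\<phi> u = \<phi> v" by (rule coords_eqI) (use assms phi_coords in auto)
  then show ?thesis using phi_bij assms by (auto simp: bij_betw_def inj_on_def)
qed

lemma phi_inv: "c \<in> coords n \<Longrightarrow> inv_into N \<phi> c \<in> N \<and> \<phi> (inv_into N \<phi> c) = c"
  using phi_bij by (auto simp: bij_betw_def f_inv_into_f inv_into_into)

lemma inv_phi: "u \<in> N \<Longrightarrow> inv_into N \<phi> (\<phi> u) = u"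
  using phi_bij by (auto simp: bij_betw_def)

abbreviation "e k \<equiv> inv_into N \<phi> (unit_vec k)"

lemma e_mem: "k \<in> I \<Longrightarrow> e k \<in> N"
  using phi_inv unit_vec_in_coords by blast

lemma phi_e: "k \<in> I \<Longrightarrow> \<phi> (e k) j = (if j = k then 1 else 0)"
  using phi_inv[OF unit_vec_in_coords[of k n]] by simp

lemma expand: assumes "u \<in> N" shows "u = (\<Sum>k\<in>I. scale (\<phi> u k) (e k))"
proof (rule phi_eqI)
  fix k assume k: "k \<in> I"
  have "\<phi> (\<Sum>k\<in>I. scale (\<phi> u k) (e k)) k = (\<Sum>j\<in>I. if k = j then \<phi> u j else 0)"
    by (subst phi_sum_apply) (simp_all add: N_closed e_mem phi_scale_apply phi_e if_distrib cong: if_cong)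
  then show "\<phi> u k = \<phi> (\<Sum>k\<in>I. scale (\<phi> u k) (e k)) k" using k by simp
next
  show "(\<Sum>k\<in>I. scale (\<phi> u k) (e k)) \<in> N"
    by (intro subspace_sum[OF N_subspace] subspace_scale[OF N_subspace] e_mem)
qed (rule assms)

section \<open>Weights of right multiplications on the nilradical\<close>

text \<open>The positions \<open>l\<close> and \<open>m\<close> carry the weights (1, 0) and (0, 1),
  so these two diagonal entries are the parameters of the entire diagonal.\<close>

definition "lam r = \<phi> (br (e l) r) l"
definition "mu r = \<phi> (br (e m) r) m"

text \<open>Right multiplication by \<open>r\<close>, transported by \<open>\<phi>\<close>, obeys
  the product rule because of \<open>br_derivation\<close>, so both assumptions on derivations of
  the coordinate algebra apply to it.\<close>

lemma
  assumes "j \<in> I" "k \<in> I"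
  shows phi_br_e_triangular: "rk k < rk j \<Longrightarrow> \<phi> (br (e j) r) k = 0"
    and phi_br_e_diagonal: "\<phi> (br (e k) r) k = of_nat (p k) * lam r + of_nat (q k) * mu r"
proof -
  define D where "D c = \<phi> (br (inv_into N \<phi> c) r)" for c
  have Dc: "D u \<in> coords n" if "u \<in> coords n" for u
    using phi_inv[OF that] by (simp add: D_def phi_coords N_closed)
  have DD: "D (sc_br n g u v) = sc_br n g (D u) v + sc_br n g u (D v)"
    if u: "u \<in> coords n" and v: "v \<in> coords n" for u v
  proof -
    let ?u = "inv_into N \<phi> u" and ?v = "inv_into N \<phi> v"
    have uv: "?u \<in> N" "?v \<in> N" "\<phi> ?u = u" "\<phi> ?v = v" using phi_inv u v by auto
    have "\<phi> (br ?u ?v) = sc_br n g u v" using uv by (simp add: phi_br)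
    then have "inv_into N \<phi> (sc_br n g u v) = br ?u ?v" using inv_phi[of "br ?u ?v"] uv N_closed by metis
    then have "D (sc_br n g u v) = \<phi> (br (br ?u r) ?v + br ?u (br ?v r))"
      by (simp add: D_def br_derivation[of ?u ?v])
    then show ?thesis using uv by (simp add: phi_add N_closed phi_br D_def)
  qed
  have deriv: "is_derivation n g D" using Dc DD by (simp add: is_derivation_def)
  show "\<phi> (br (e j) r) k = 0" if "rk k < rk j"
    using derivation_triangular[OF deriv assms that] by (simp add: matrix_of_def D_def)
  show "\<phi> (br (e k) r) k = of_nat (p k) * lam r + of_nat (q k) * mu r"
    using derivation_diagonal[OF deriv assms(2)] by (simp add: matrix_of_def D_def lam_def mu_def)
qed

text \<open>In the lowest weight present in \<open>u\<close> only the diagonal entry contributes: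
  lower coordinates of \<open>u\<close> are zero, and basis vectors of higher weight have images
  without a component at \<open>k\<close>.\<close>

lemma triangular:
  assumes u: "u \<in> N" and k: "k \<in> I" and z: "\<And>j. j \<in> I \<Longrightarrow> rk j < rk k \<Longrightarrow> \<phi> u j = 0"
  shows "\<phi> (br u r) k = (of_nat (p k) * lam r + of_nat (q k) * mu r) * \<phi> u k"
proof -
  have "br u r = (\<Sum>j\<in>I. scale (\<phi> u j) (br (e j) r))"
    by (subst expand[OF u]) (simp add: br_sum_left br_scale_left)
  then have "\<phi> (br u r) k = (\<Sum>j\<in>I. \<phi> u j * \<phi> (br (e j) r) k)"
    by (simp add: phi_sum_apply N_closed e_mem phi_scale_apply)
  also have "\<dots> = (\<Sum>j\<in>I. if j = k then \<phi> u k * \<phi> (br (e k) r) k else 0)"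
  proof (rule sum.cong[OF refl])
    fix j assume j: "j \<in> I"
    consider "j = k" | "rk j < rk k" | "rk k < rk j"
      using rk_inj j k by (meson inj_onD linorder_neqE_nat)
    then show "\<phi> u j * \<phi> (br (e j) r) k = (if j = k then \<phi> u k * \<phi> (br (e k) r) k else 0)"
      by cases (use z j k phi_br_e_triangular in auto)
  qed
  also have "\<dots> = \<phi> u k * \<phi> (br (e k) r) k" using k by simp
  finally show ?thesis using phi_br_e_diagonal[OF k k] by (simp add: mult.commute)
qed

lemma lam_add: "lam (r + s) = lam r + lam s"
  and mu_add: "mu (r + s) = mu r + mu s"
  and lam_scale: "lam (scale a r) = a * lam r"
  and mu_scale: "mu (scale a r) = a * mu r"
  using l m by (simp_all add: lam_def mu_def br_add_right br_scale_right phi_simps N_closed e_mem)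

lemma lam_diff: "lam (r - s) = lam r - lam s"
  and mu_diff: "mu (r - s) = mu r - mu s"
  using lam_add[of "r - s" s] mu_add[of "r - s" s] by simp_all

text \<open>A nonzero term would need \<open>rk k = rk k + rk j\<close>, against
  \<open>rk_pos\<close>.\<close>

lemma phi_br_diag_eq_0:
  assumes u: "u \<in> N" and k: "k \<in> I"
  shows "\<phi> (br (e k) u) k = 0"
proof -
  have "(\<Sum>i\<in>I. \<Sum>j\<in>I. \<phi> (e k) i * \<phi> u j * g i j k) = 0"
  proof (intro sum.neutral ballI)
    fix i j assume ij: "i \<in> I" "j \<in> I"
    show "\<phi> (e k) i * \<phi> u j * g i j k = 0"
      using homog[of k j k] rk_pos[of j] ij k by (cases "i = k") (auto simp: phi_e)
  qed
  then show ?thesis using u k by (simp add: phi_br e_mem sc_br_def)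
qed

lemma lam_N: "u \<in> N \<Longrightarrow> lam u = 0" and mu_N: "u \<in> N \<Longrightarrow> mu u = 0"
  using phi_br_diag_eq_0 l m by (simp_all add: lam_def mu_def)

text \<open>By \<open>br_br\<close>, right multiplication by \<open>br r s\<close> is a commutator
  of two triangular maps, and diagonals of triangular maps multiply commutatively.\<close>

lemma phi_br_commutator_diag:
  assumes k: "k \<in> I"
  shows "\<phi> (br (e k) (br r s)) k = 0"
proof -
  have low: "\<phi> (br (e k) t) j = 0" if "j \<in> I" "rk j < rk k" for j t
    using phi_br_e_triangular that k by blast
  have "\<phi> (br (br (e k) r) s) k = \<phi> (br (br (e k) s) r) k"
    using k low by (simp add: triangular[OF N_br_left[OF e_mem]] phi_br_e_diagonal)
  then show ?thesis
    using k by (simp add: br_br phi_simps N_closed e_mem)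
qed

lemma lam_br: "lam (br r s) = 0" and mu_br: "mu (br r s) = 0"
  using phi_br_commutator_diag l m by (simp_all add: lam_def mu_def)

lemma br_antisym_N:
  assumes "u \<in> N" "v \<in> N" shows "br u v = - br v u"
proof (rule phi_eqI)
  fix k
  have "\<phi> (- br v u) k = - \<phi> (br v u) k"
    using phi_scale_apply[of "br v u" "-1" k] assms N_closed by simp
  then show "\<phi> (br u v) k = \<phi> (- br v u) k"
    using assms sc_br_swap[of g n "\<phi> u" "\<phi> v", OF anti] by (simp add: phi_br)
qed (simp_all add: assms N_closed)

text \<open>Filtration of \<open>N\<close> by weight. The level is an arbitrary natural number, so
  that inductions can go up by one; at a level that is not a weight, \<open>flag i\<close> and
  \<open>flag (Suc i)\<close> coincide.\<close>

definition "flag i = {u \<in> N. \<forall>j\<in>I. rk j < i \<longrightarrow> \<phi> u j = 0}"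

lemma flag_subspace: "subspace (flag i)"
  by (auto simp: subspace_def flag_def N_closed phi_simps)

lemma flag_0: "flag 0 = N" by (auto simp: flag_def)

lemma flag_eventually_0:
  "\<exists>b. \<forall>i\<ge>b. flag i = {0}"
proof (intro exI allI impI)
  fix i assume i: "Suc (\<Sum>k\<in>I. rk k) \<le> i"
  have "rk k < i" if "k \<in> I" for k
    using member_le_sum[of k I rk] that i by simp
  then show "flag i = {0}"
    by (auto simp: flag_def N_closed phi_zero_apply intro!: phi_eqI)
qed

text \<open>Vanishing \<open>lam\<close> and \<open>mu\<close> mean a zero diagonal, hence a
  strictly triangular right multiplication.\<close>

lemma flag_br:
  assumes "u \<in> flag i" "lam r = 0" "mu r = 0"
  shows "br u r \<in> flag (Suc i)"
proof -
  have "\<phi> (br u r) j = 0" if "j \<in> I" "rk j < Suc i" for j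
    using assms that by (subst triangular) (auto simp: flag_def)
  then show ?thesis using assms by (auto simp: flag_def N_closed)
qed


section \<open>Codimension two and maximality of the nilradical\<close>

lemma dim_N: "dim N = n"
proof -
  have inj: "inj_on e I"
  proof (rule inj_onI)
    fix i j assume ij: "i \<in> I" "j \<in> I" "e i = e j"
    then have "\<phi> (e j) i = 1" using phi_e[of i i] by simp
    then show "i = j" using phi_e[of j i] ij by (simp split: if_splits)
  qed
  have indep: "independent (e ` I)"
  proof (rule independent_if_scalars_zero)
    fix f x assume f: "(\<Sum>x\<in>e ` I. scale (f x) x) = 0" and "x \<in> e ` I"
    then obtain k where k: "k \<in> I" "x = e k" by blast
    have "0 = \<phi> (\<Sum>j\<in>I. scale (f (e j)) (e j)) k"
      using f by (simp add: sum.reindex[OF inj] phi_zero_apply)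
    also have "\<dots> = f (e k)"
      using k by (subst phi_sum_apply)
        (simp_all add: N_closed e_mem phi_scale_apply phi_e if_distrib cong: if_cong)
    finally show "f x = 0" using k by simp
  qed simp
  have "N \<subseteq> span (e ` I)"
  proof
    fix u assume "u \<in> N"
    then have "u = (\<Sum>k\<in>I. scale (\<phi> u k) (e k))" by (rule expand)
    moreover have "(\<Sum>k\<in>I. scale (\<phi> u k) (e k)) \<in> span (e ` I)"
      by (intro span_sum span_scale span_base) auto
    ultimately show "u \<in> span (e ` I)" by simp
  qed
  moreover have "e ` I \<subseteq> N" using e_mem by blast
  ultimately show ?thesis using dim_unique[OF _ _ indep] card_image[OF inj] by simp
qed

lemma complement:
  assumes "c \<notin> N"
  obtains d where "d \<notin> span (insert c N)" "\<And>r. \<exists>a b. r - scale a d - scale b c \<in> N"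
proof -
  obtain Ba where Ba: "independent Ba" "span Ba = UNIV" "card Ba = n + 2"
    using basis_exists[of UNIV] dim_UNIV by (metis top.extremum_uniqueI)
  then have "finite Ba" using card.infinite by force
  then interpret fd: finite_dimensional_vector_space scale Ba
    by unfold_locales (use Ba in auto)
  have N: "span N = N" using N_subspace by (simp add: span_eq_iff)
  have dc: "dim (insert c N) = n + 1"
    using assms by (simp add: fd.dim_insert N dim_N)
  have "span (insert c N) \<noteq> UNIV"
    using dc dim_UNIV dim_span[of "insert c N"] by force
  then obtain d where d: "d \<notin> span (insert c N)" by blast
  then have "dim (insert d (insert c N)) = n + 2" using dc by (simp add: fd.dim_insert)
  then have "span (insert d (insert c N)) = UNIV"
    by (intro fd.subspace_dim_equal) (use dim_UNIV in \<open>auto simp: dim_span simp del: fd.dim_UNIV\<close>)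
  then have "\<exists>a b. r - scale a d - scale b c \<in> N" for r
    using span_breakdown_eq[of r d "insert c N"] by (auto simp: span_breakdown_eq N)
  with d show thesis using that by blast
qed

lemma N_neq_UNIV: "N \<noteq> UNIV"
  using dim_N dim_UNIV by auto

text \<open>The span of \<open>N\<close> and \<open>c\<close> absorbs all brackets, so it is an
  ideal, and its elements act on \<open>N\<close> by strictly triangular right multiplications. Once
  its own brackets fall into \<open>N\<close> it is nilpotent, contrary to the maximality of
  \<open>N\<close>; the delicate point is \<open>br c c\<close>.\<close>

lemma no_larger_ideal:
  assumes c: "c \<notin> N" "lam c = 0" "mu c = 0" and br_in: "\<And>r s. br r s \<in> span (insert c N)"
  shows False
proof -
  define M where "M = span (insert c N)"
  have N: "span N = N" using N_subspace by (simp add: span_eq_iff)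
  have M_iff: "x \<in> M \<longleftrightarrow> (\<exists>a. x - scale a c \<in> N)" for x
    by (simp add: M_def span_breakdown_eq N)
  have NM: "N \<subseteq> M" and cM: "c \<in> M" by (auto simp: M_def intro: span_base)
  have ideal: "is_ideal scale br M"
    using br_in by (simp add: is_ideal_def M_def)
  have lam_M: "lam x = 0" and mu_M: "mu x = 0" if x: "x \<in> M" for x
  proof -
    obtain a where "x - scale a c \<in> N" using x M_iff by blast
    then have "lam (x - scale a c) = 0" "mu (x - scale a c) = 0" using lam_N mu_N by auto
    then show "lam x = 0" "mu x = 0" using c by (simp_all add: lam_diff mu_diff lam_scale mu_scale)
  qed
  have cc: "br c c \<in> N"
  proof -
    obtain a where a: "br c c - scale a c \<in> N" using br_in[of c c] M_iff M_def by blast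
    \<comment> \<open>The two terms of the Leibniz identity cancel. With \<open>br c c\<close> equal
      to \<open>scale a c\<close> modulo \<open>N\<close>, this puts first
      \<open>scale a (br c c)\<close> and then \<open>scale (a * a) c\<close> into \<open>N\<close>,
      so \<open>a = 0\<close>.\<close>
    have "br c (br c c) = 0" by (simp add: br_br)
    moreover have "br c (br c c - scale a c) \<in> N" using a by (rule N_br_right)
    ultimately have "scale a (br c c) \<in> N"
      using N_closed(5)[of "br c (br c c - scale a c)"] by (simp add: br_diff_right br_scale_right)
    then have "scale a (br c c) - scale a (br c c - scale a c) \<in> N" using a N_closed by blast
    then have aac: "scale (a * a) c \<in> N" by (simp add: scale_right_diff_distrib)
    have "a = 0"
    proof (rule ccontr)
      assume "a \<noteq> 0"
      then have "scale (inverse (a * a)) (scale (a * a) c) = c"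
        by (metis scale_scale left_inverse mult_eq_0_iff scale_one)
      then show False using N_closed(4)[OF aac, of "inverse (a * a)"] c(1) by simp
    qed
    then show ?thesis using a by simp
  qed
  have MM: "br x y \<in> N" if xy: "x \<in> M" "y \<in> M" for x y
  proof -
    obtain a b where ab: "x - scale a c \<in> N" "y - scale b c \<in> N" using xy M_iff by blast
    have "br x y = br (x - scale a c) y + scale a (br c (y - scale b c)) + scale (a * b) (br c c)"
      by (simp add: br_diff_left br_diff_right br_scale_left br_scale_right scale_right_diff_distrib)
    then show ?thesis using ab cc N_closed by metis
  qed
  \<comment> \<open>The index is shifted by one because \<open>M\<close> itself is not contained in
    \<open>flag 0 = N\<close>, while its first brackets are.\<close>
  have lc: "lower_central scale br M (Suc k) \<subseteq> flag k" for k
  proof (induction k)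
    case 0
    show ?case unfolding lower_central.simps
      by (rule span_minimal) (auto simp: MM flag_0 N_subspace)
  next
    case (Suc k)
    have "br a b \<in> flag (Suc k)" if "a \<in> lower_central scale br M (Suc k)" "b \<in> M" for a b
      using that Suc lam_M mu_M by (intro flag_br) auto
    then show ?case unfolding lower_central.simps(2)[of _ _ _ "Suc k"]
      by (intro span_minimal flag_subspace) auto
  qed
  obtain b where b: "flag b = {0}" using flag_eventually_0 by blast
  have "0 \<in> lower_central scale br M (Suc b)"
    unfolding lower_central.simps by (rule span_zero)
  then have "lower_central scale br M (Suc b) = {0}"
    using lc[of b] unfolding b by blast
  then have "nilpotent_on scale br M" unfolding nilpotent_on_def by blast
  then have "M = N" using nilradical ideal NM by (auto simp: is_nilradical_def)
  then show False using cM c(1) by simp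
qed

text \<open>If two brackets span the algebra modulo \<open>N\<close>, then by induction every term
  of the derived series still covers everything modulo \<open>N\<close>. The term that is zero would
  give \<open>N = UNIV\<close>.\<close>

lemma not_perfect:
  assumes cd: "c = br r1 s1" "d = br r2 s2" and all: "\<And>r. \<exists>a b. r - scale a d - scale b c \<in> N"
  shows False
proof -
  have "\<exists>x\<in>derived_series scale br k. r - x \<in> N" for k r
  proof (induction k arbitrary: r)
    case 0
    have "r - r \<in> N" using N_closed by simp
    then show ?case by (intro bexI[of _ r]) simp_all
  next
    case (Suc k)
    let ?S = "derived_series scale br (Suc k)"
    have S: "subspace ?S" by simp
    have br: "\<exists>x\<in>?S. br r s - x \<in> N" for r s
    proof -
      obtain x y where xy: "x \<in> derived_series scale br k" "r - x \<in> N"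
        "y \<in> derived_series scale br k" "s - y \<in> N" using Suc by meson
      have "br x y \<in> ?S" using xy by (auto intro: span_base)
      moreover have "br r s - br x y = br (r - x) s + br x (s - y)"
        by (simp add: br_diff_left br_diff_right)
      ultimately show ?thesis using xy N_closed by metis
    qed
    obtain a b where ab: "r - scale a d - scale b c \<in> N" using all by blast
    obtain x y where xy: "x \<in> ?S" "d - x \<in> N" "y \<in> ?S" "c - y \<in> N" using br cd by metis
    have "r - (scale a x + scale b y)
        = (r - scale a d - scale b c) + scale a (d - x) + scale b (c - y)"
      by (simp add: scale_right_diff_distrib)
    moreover have "scale a x + scale b y \<in> ?S" using xy S subspace_add subspace_scale by blast
    ultimately show ?case using ab xy N_closed by metis
  qed
  moreover obtain k where "derived_series scale br k = {0}"
    using solvable by (auto simp: solvable_alg_def)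
  ultimately have "r \<in> N" for r by (metis diff_zero singletonD)
  then show False using N_neq_UNIV by blast
qed

text \<open>If all brackets lie in \<open>N\<close>, then \<open>N\<close> together with
  \<open>r\<close> contradicts \<open>no_larger_ideal\<close>. Otherwise take a bracket
  \<open>?c\<close> outside \<open>N\<close>; the same lemma, applied to \<open>?c\<close>, yields a
  second bracket outside the span of \<open>N\<close> and \<open>?c\<close>. Since \<open>N\<close>
  has codimension 2, the two brackets span everything modulo \<open>N\<close>, which solvability
  forbids.\<close>

lemma kernel_in_N:
  assumes "lam r = 0" "mu r = 0" shows "r \<in> N"
proof (rule ccontr)
  assume r: "r \<notin> N"
  show False
  proof (cases "\<forall>x y. br x y \<in> N")
    case True
    then show False
      using no_larger_ideal[OF r assms] by (meson span_base subset_insertI subset_iff)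
  next
    case False
    then obtain x y where c: "br x y \<notin> N" by blast
    let ?c = "br x y"
    have "\<exists>x' y'. br x' y' \<notin> span (insert ?c N)"
      using no_larger_ideal[OF c lam_br mu_br] by blast
    then obtain x' y' where d: "br x' y' \<notin> span (insert ?c N)" by blast
    obtain d0 where d0: "\<And>r. \<exists>a b. r - scale a d0 - scale b ?c \<in> N"
      using complement[OF c] by blast
    obtain a b where ab: "br x' y' - scale a d0 - scale b ?c \<in> N" using d0 by blast
    have N: "span N = N" using N_subspace by (simp add: span_eq_iff)
    have a: "a \<noteq> 0"
      using d ab by (auto simp: span_breakdown_eq N)
    have "\<exists>s t. r - scale s (br x' y') - scale t ?c \<in> N" for r
    proof -
      obtain s t where st: "r - scale s d0 - scale t ?c \<in> N" using d0 by blast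
      \<comment> \<open>The relation \<open>ab\<close> is solved for \<open>d0\<close>, which is
        possible since \<open>a\<close> is nonzero, and substituted into \<open>st\<close>.\<close>
      have "r - scale (s / a) (br x' y') - scale (t - s * b / a) ?c
        = (r - scale s d0 - scale t ?c) - scale (s / a) (br x' y' - scale a d0 - scale b ?c)"
        using a by (simp add: scale_right_diff_distrib scale_left_diff_distrib)
      then show ?thesis using st ab N_closed by metis
    qed
    then show False by (rule not_perfect[OF refl refl])
  qed
qed

lemma br_in_N: "br r s \<in> N"
  by (rule kernel_in_N[OF lam_br mu_br])

text \<open>Cramer's rule for two vectors independent modulo \<open>N\<close>. A zero determinant
  \<open>D\<close> would put combinations of them into the common kernel of \<open>lam\<close> and
  \<open>mu\<close>, hence into \<open>N\<close>.\<close>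

lemma torus_coordinates:
  obtains x y where "lam x = 1" "mu x = 0" "lam y = 0" "mu y = 1"
proof -
  obtain c where c: "c \<notin> N" using N_neq_UNIV by blast
  obtain d where d: "d \<notin> span (insert c N)" by (rule complement[OF c])
  have N: "span N = N" using N_subspace by (simp add: span_eq_iff)
  define D where "D = lam c * mu d - lam d * mu c"
  have indep: "scale a c - scale b d \<notin> N" if "b \<noteq> 0" for a b
  proof
    assume "scale a c - scale b d \<in> N"
    then have "scale (- inverse b) (scale a c - scale b d) \<in> N" by (rule N_closed)
    then have "d - scale (a / b) c \<in> N"
      using that by (simp add: scale_right_diff_distrib divide_inverse mult.commute)
    then show False using d by (auto simp: span_breakdown_eq N)
  qed
  have D0: "D \<noteq> 0"
  proof
    assume D: "D = 0"
    have "scale (mu d) c - scale (mu c) d \<in> N" "scale (lam d) c - scale (lam c) d \<in> N"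
      using D by (auto intro!: kernel_in_N simp: D_def lam_diff mu_diff lam_scale mu_scale mult.commute)
    then have "mu c = 0" "lam c = 0" using indep by blast+
    then show False using c kernel_in_N by blast
  qed
  show thesis
  proof (rule that)
    show "lam (scale (mu d / D) c - scale (mu c / D) d) = 1"
      "mu (scale (mu d / D) c - scale (mu c / D) d) = 0"
      "lam (scale (lam c / D) d - scale (lam d / D) c) = 0"
      "mu (scale (lam c / D) d - scale (lam d / D) c) = 1"
      using D0 by (auto simp: lam_diff mu_diff lam_scale mu_scale D_def divide_simps)
  qed
qed


section \<open>Spectral decomposition of the nilradical under h\<close>

context
  fixes h
  assumes h: "lam h = 1" "mu h = of_nat n"
begin

lemma phi_br_h:
  assumes "u \<in> N" "k \<in> I" "\<And>j. j \<in> I \<Longrightarrow> rk j < rk k \<Longrightarrow> \<phi> u j = 0"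
  shows "\<phi> (br u h) k = of_nat (rk k) * \<phi> u k"
  using triangular[OF assms, of h] by (simp add: h rk_def algebra_simps)

text \<open>Elimination along the filtration: if \<open>i\<close> is the weight of \<open>k\<close>,
  dividing the leading coefficient of \<open>t\<close> by \<open>i - c\<close> removes it and leaves
  a remainder one level higher. Only weights from level \<open>i\<close> on are divided by, so
  \<open>c\<close> may itself be a smaller weight.\<close>

lemma flag_solve:
  assumes "t \<in> flag i" "\<And>k. k \<in> I \<Longrightarrow> i \<le> rk k \<Longrightarrow> of_nat (rk k) \<noteq> (c :: complex)"
  shows "\<exists>v\<in>flag i. br v h - scale c v = t"
proof -
  obtain b where b: "\<forall>i\<ge>b. flag i = {0}" using flag_eventually_0 by blast
  \<comment> \<open>Here \<open>d\<close> counts the levels left before the filtration reaches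
    zero.\<close>
  have "b \<le> i + d \<Longrightarrow> ?thesis" for d
    using assms
  proof (induction d arbitrary: i t)
    case 0
    then show ?case using b by simp
  next
    case (Suc d)
    have step: "\<exists>v\<in>flag i. br v h - scale c v = s" if s: "s \<in> flag (Suc i)" for s
    proof -
      have "\<exists>v\<in>flag (Suc i). br v h - scale c v = s"
        by (rule Suc.IH) (use Suc.prems s in auto)
      then show ?thesis by (auto simp: flag_def)
    qed
    show ?case
    proof (cases "\<exists>k\<in>I. rk k = i")
      case False
      then have "t \<in> flag (Suc i)" using Suc.prems(2) by (auto simp: flag_def less_Suc_eq)
      then show ?thesis by (rule step)
    next
      case True
      then obtain k where k: "k \<in> I" "rk k = i" by blast
      define w where "w = scale (\<phi> t k / (of_nat i - c)) (e k)"
      have c: "of_nat i - c \<noteq> 0" using Suc.prems(3)[OF k(1)] k by simp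
      have wN: "w \<in> N" using k by (simp add: w_def e_mem N_closed)
      have phi_w: "\<phi> w j = (if j = k then \<phi> t k / (of_nat i - c) else 0)" for j
        using k by (simp add: w_def phi_simps e_mem phi_e)
      have wi: "w \<in> flag i" using wN k phi_w by (auto simp: flag_def)
      have "t - (br w h - scale c w) \<in> flag (Suc i)"
      proof -
        have "\<phi> (t - (br w h - scale c w)) j = 0" if j: "j \<in> I" "rk j < Suc i" for j
        proof -
          have tN: "t \<in> N" and tj: "rk j < i \<Longrightarrow> \<phi> t j = 0" using Suc.prems(2) j by (auto simp: flag_def)
          have "\<phi> (br w h) j = of_nat (rk j) * \<phi> w j"
            using j wN k phi_w by (intro phi_br_h) auto
          moreover have "j = k \<or> rk j < i"
            using j k rk_inj by (metis inj_onD less_antisym)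
          ultimately show ?thesis
            using tN wN tj phi_w k c by (auto simp: phi_simps N_closed field_simps)
        qed
        moreover have "t - (br w h - scale c w) \<in> N"
          using Suc.prems(2) wN by (simp add: flag_def N_closed)
        ultimately show ?thesis by (auto simp: flag_def)
      qed
      then obtain v where v: "v \<in> flag i" "br v h - scale c v = t - (br w h - scale c w)"
        using step by blast
      have "br (v + w) h - scale c (v + w) = t"
        using v(2) by (simp add: br_add_left scale_right_distrib algebra_simps)
      moreover have "v + w \<in> flag i" using v wi flag_subspace subspace_add by blast
      ultimately show ?thesis by blast
    qed
  qed
  then show ?thesis using le_add2 by blast
qed

text \<open>The lowest nonzero coordinate of an eigenvector sits at a weight equal to the
  eigenvalue. As the weights are distinct, the last premise concerns at most one coordinate.\<close>

lemma eigenvector_eq_0: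
  assumes u: "u \<in> N" "br u h = scale c u"
    and "\<And>k. k \<in> I \<Longrightarrow> of_nat (rk k) = c \<Longrightarrow> \<phi> u k = 0"
  shows "u = 0"
proof -
  have "k \<in> I \<Longrightarrow> \<phi> u k = 0" for k
  proof (induction k rule: measure_induct_rule[of rk])
    case (less k)
    have "c * \<phi> u k = of_nat (rk k) * \<phi> u k"
      using phi_br_h[OF u(1) less.prems] less.IH u by (simp add: phi_scale_apply)
    then show ?case using assms(3)[OF less.prems] by auto
  qed
  then show ?thesis by (intro phi_eqI) (simp_all add: u N_closed phi_zero_apply)
qed

lemma br_h_eq_0: "u \<in> N \<Longrightarrow> br u h = 0 \<Longrightarrow> u = 0"
  by (rule eigenvector_eq_0[of u 0]) (auto dest!: rk_pos)

text \<open>\<open>e k\<close> is an eigenvector up to terms of higher weight. From level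
  \<open>Suc (rk k)\<close> on, \<open>rk k\<close> is no longer among the weights, so
  \<open>flag_solve\<close> supplies the correction.\<close>

lemma eigenvector:
  assumes k: "k \<in> I"
  shows "\<exists>b\<in>N. br b h = scale (of_nat (rk k)) b \<and> \<phi> b k = 1 \<and> (\<forall>j\<in>I. rk j < rk k \<longrightarrow> \<phi> b j = 0)"
proof -
  let ?c = "of_nat (rk k) :: complex"
  let ?t = "br (e k) h - scale ?c (e k)"
  have "\<phi> ?t j = 0" if j: "j \<in> I" "rk j < Suc (rk k)" for j
  proof -
    have "\<phi> (br (e k) h) j = of_nat (rk j) * \<phi> (e k) j"
      using j k by (intro phi_br_h) (auto simp: e_mem phi_e)
    then show ?thesis using j k by (auto simp: phi_simps N_closed e_mem phi_e)
  qed
  then have "?t \<in> flag (Suc (rk k))" using k by (auto simp: flag_def N_closed e_mem)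
  then obtain v where v: "v \<in> flag (Suc (rk k))" "br v h - scale ?c v = ?t"
    using flag_solve[of ?t "Suc (rk k)" ?c] by auto
  have vN: "v \<in> N" and v0: "\<And>j. j \<in> I \<Longrightarrow> rk j < Suc (rk k) \<Longrightarrow> \<phi> v j = 0"
    using v by (auto simp: flag_def)
  show ?thesis
  proof (intro bexI conjI ballI impI)
    show "br (e k - v) h = scale ?c (e k - v)"
      using v(2) by (simp add: br_diff_left scale_right_diff_distrib algebra_simps)
    show "\<phi> (e k - v) k = 1" using vN v0 k by (simp add: phi_simps e_mem phi_e)
    show "\<phi> (e k - v) j = 0" if "j \<in> I" "rk j < rk k" for j
      using vN v0 k that by (auto simp: phi_simps e_mem phi_e)
    show "e k - v \<in> N" using vN k by (simp add: e_mem N_closed)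
  qed
qed

section \<open>From Leibniz to Lie\<close>

lemma right_annihilator_in_N:
  assumes "\<And>r. br r z = 0" shows "z \<in> N"
  using assms by (intro kernel_in_N) (simp_all add: lam_def mu_def phi_zero_apply)

lemma right_annihilator_square: "br r (br a b + br b a) = 0"
  by (simp add: br_add_right br_br)

text \<open>For \<open>w\<close> in \<open>N\<close> the element \<open>br s w + br w s\<close>
  annihilates from the right, hence inside \<open>N\<close> also from the left. So
  \<open>br s u\<close> may be replaced by \<open>- br u s\<close> in the Leibniz expansion of
  \<open>br s (br u v)\<close>, and likewise for \<open>v\<close>; the result is the product rule
  for \<open>br (br u v) s\<close> with a minus sign.\<close>

lemma br_antisym_derived:
  assumes u: "u \<in> N" and v: "v \<in> N"
  shows "br s (br u v) = - br (br u v) s"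
proof -
  have sq: "br (br s w + br w s) w' = 0" if w: "w \<in> N" "w' \<in> N" for w w'
    using br_antisym_N[of "br s w + br w s" w'] w right_annihilator_square[of w' s w] by (simp add: N_closed)
  have su: "br (br s u) v = - br (br u s) v" and sv: "br (br s v) u = - br (br v s) u"
    using sq[OF u v] sq[OF v u] by (simp_all add: br_add_left add_eq_0_iff2)
  have "br (br v s) u = - br u (br v s)"
    using u v by (intro br_antisym_N N_br_left)
  then show ?thesis
    by (simp add: br_br[of s u v] su sv br_derivation[of u v s])
qed

text \<open>A right-annihilating element is central in \<open>N\<close>, hence a bracket of elements of \<open>N\<close>, on which
  the bracket with \<open>h\<close> is antisymmetric; as \<open>h\<close> acts invertibly on \<open>N\<close>, it vanishes.\<close>

lemma br_antisym: "br r s = - br s r"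
proof -
  define z where "z = br r s + br s r"
  have z: "br t z = 0" for t unfolding z_def by (rule right_annihilator_square)
  then have zN: "z \<in> N" by (rule right_annihilator_in_N)
  have "sc_br n g v (\<phi> z) = 0" if "v \<in> coords n" for v
  proof -
    have "sc_br n g v (\<phi> z) = \<phi> (br (inv_into N \<phi> v) z)"
      using phi_inv[OF that] zN by (simp add: phi_br)
    then show ?thesis by (simp add: z phi_zero_apply fun_eq_iff)
  qed
  then obtain u v where uv: "u \<in> coords n" "v \<in> coords n" "\<phi> z = sc_br n g u v"
    using center[OF phi_coords[OF zN]] by blast
  let ?u = "inv_into N \<phi> u" and ?v = "inv_into N \<phi> v"
  have uvN: "?u \<in> N" "?v \<in> N" using phi_inv uv by auto
  have "z = br ?u ?v"
    using uv uvN phi_inv by (intro phi_eqI) (auto simp: zN N_closed phi_br)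
  then have "br z h = 0" using br_antisym_derived[OF uvN, of h] z[of h] by simp
  then have "z = 0" by (rule br_h_eq_0[OF zN])
  then show ?thesis by (simp add: z_def add_eq_0_iff2)
qed

section \<open>The centralizer of h as a complement\<close>

text \<open>All weights are positive, so right multiplication by \<open>h\<close> is onto
  \<open>N\<close>, and \<open>br r h\<close> already lies in \<open>N\<close>.\<close>

lemma commuting_representative:
  obtains w where "w \<in> N" "br (r - w) h = 0"
proof -
  have "br r h \<in> flag 0"
    unfolding flag_0 by (rule br_in_N)
  then have "\<exists>v\<in>flag 0. br v h - scale 0 v = br r h"
    by (rule flag_solve) (auto dest: rk_pos)
  then obtain v where "v \<in> flag 0" "br v h - scale 0 v = br r h"
    by blast
  then show thesis using that[of v] by (simp add: flag_0 br_diff_left)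
qed

text \<open>By the product rule \<open>h\<close> kills \<open>br x y\<close>, which lies in
  \<open>N\<close>, where \<open>h\<close> acts injectively.\<close>

lemma torus_commutes:
  assumes "br x h = 0" "br y h = 0" shows "br x y = 0"
  by (rule br_h_eq_0[OF br_in_N]) (simp add: assms br_derivation[of x y h])

text \<open>Right multiplication by \<open>x\<close> commutes with that by \<open>h\<close> and so
  preserves the one-dimensional eigenspace of \<open>b\<close>; the scalar is read off at the
  leading coordinate.\<close>

lemma torus_eigenvector:
  assumes b: "b \<in> N" "br b h = scale (of_nat (rk k)) b" "\<phi> b k = 1"
      "\<And>j. j \<in> I \<Longrightarrow> rk j < rk k \<Longrightarrow> \<phi> b j = 0"
    and k: "k \<in> I" and x: "br x h = 0"
  shows "br b x = scale (of_nat (p k) * lam x + of_nat (q k) * mu x) b"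
proof -
  let ?w = "of_nat (p k) * lam x + of_nat (q k) * mu x"
  have "br b x - scale ?w b = 0"
  proof (rule eigenvector_eq_0)
    show "br b x - scale ?w b \<in> N" using b by (simp add: N_closed)
    show "br (br b x - scale ?w b) h = scale (of_nat (rk k)) (br b x - scale ?w b)"
      by (simp add: br_diff_left br_scale_left br_derivation[of b x h] x b(2) scale_right_diff_distrib mult.commute)
    fix j assume "j \<in> I" "of_nat (rk j) = (of_nat (rk k) :: complex)"
    then have "j = k" using k rk_inj by (auto dest: inj_onD)
    then show "\<phi> (br b x - scale ?w b) j = 0"
      using triangular[OF b(1) k b(4), of x] b k by (simp add: phi_simps N_closed)
  qed
  then show ?thesis by simp
qed

end

section \<open>Unitriangular bases and the isomorphism\<close>

lemma rk_cases:
  assumes "j \<in> I" "k \<in> I"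
  obtains "j = k" | "rk j < rk k" | "rk k < rk j"
  using assms rk_inj by (meson inj_onD linorder_neqE_nat)

lemma triangular_basis_independent:
  assumes b: "\<And>k. k \<in> I \<Longrightarrow> b k \<in> N" "\<And>k. k \<in> I \<Longrightarrow> \<phi> (b k) k = 1"
      "\<And>j k. \<lbrakk>k \<in> I; j \<in> I; rk j < rk k\<rbrakk> \<Longrightarrow> \<phi> (b k) j = 0"
    and zero: "(\<Sum>k\<in>I. scale (a k) (b k)) = 0"
  shows "k \<in> I \<Longrightarrow> a k = 0"
proof (induction k rule: measure_induct_rule[of rk])
  case (less k)
  have "0 = \<phi> (\<Sum>j\<in>I. scale (a j) (b j)) k" by (simp add: zero phi_zero_apply)
  also have "\<dots> = (\<Sum>j\<in>I. a j * \<phi> (b j) k)"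
    by (simp add: phi_sum_apply b N_closed phi_scale_apply)
  also have "\<dots> = (\<Sum>j\<in>I. if j = k then a k else 0)"
  proof (rule sum.cong[OF refl])
    fix j assume j: "j \<in> I"
    show "a j * \<phi> (b j) k = (if j = k then a k else 0)"
      using j less.prems by (rule rk_cases) (use less j b in auto)
  qed
  finally show ?case using less.prems by simp
qed

lemma triangular_basis_spanning:
  assumes b: "\<And>k. k \<in> I \<Longrightarrow> b k \<in> N" "\<And>k. k \<in> I \<Longrightarrow> \<phi> (b k) k = 1"
      "\<And>j k. \<lbrakk>k \<in> I; j \<in> I; rk j < rk k\<rbrakk> \<Longrightarrow> \<phi> (b k) j = 0"
    and u: "u \<in> N"
  shows "\<exists>a. u = (\<Sum>k\<in>I. scale (a k) (b k))"
proof -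
  obtain i0 where i0: "\<forall>i\<ge>i0. flag i = {0}" using flag_eventually_0 by blast
  have "\<lbrakk>i0 \<le> i + d; u \<in> flag i\<rbrakk> \<Longrightarrow> \<exists>a. u = (\<Sum>k\<in>I. scale (a k) (b k))" for d i u
  proof (induction d arbitrary: i u)
    case 0
    then have "u = (\<Sum>k\<in>I. scale 0 (b k))" using i0 by simp
    then show ?case by (rule exI[of _ "\<lambda>_. 0"])
  next
    case (Suc d)
    show ?case
    proof (cases "\<exists>k\<in>I. rk k = i")
      case False
      then have "u \<in> flag (Suc i)" using Suc.prems(2) by (auto simp: flag_def less_Suc_eq)
      then show ?thesis using Suc.IH[of "Suc i" u] Suc.prems by simp
    next
      case True
      then obtain k where k: "k \<in> I" "rk k = i" by blast
      let ?u = "u - scale (\<phi> u k) (b k)"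
      have uN: "u \<in> N" using Suc.prems by (simp add: flag_def)
      have "\<phi> ?u j = 0" if j: "j \<in> I" "rk j < Suc i" for j
        using j(1) k(1) by (rule rk_cases)
          (use j k b uN Suc.prems(2) in \<open>auto simp: phi_simps N_closed flag_def\<close>)
      then have "?u \<in> flag (Suc i)" using uN k b by (simp add: flag_def N_closed)
      then obtain a where a: "?u = (\<Sum>k\<in>I. scale (a k) (b k))"
        using Suc.IH[of "Suc i" ?u] Suc.prems by auto
      have "(\<Sum>j\<in>I. scale (a j + (if j = k then \<phi> u k else 0)) (b j))
          = ?u + (\<Sum>j\<in>I. if j = k then scale (\<phi> u k) (b k) else 0)"
        unfolding a scale_left_distrib sum.distrib
        by (intro arg_cong2[of _ _ _ _ "(+)"] refl sum.cong) auto
      also have "\<dots> = u" using k by simp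
      finally show ?thesis by metis
    qed
  qed
  then show ?thesis using u flag_0 le_add2 by blast
qed

theorem isomorphic_ext2:
  assumes \<alpha>: "\<And>k. k \<in> {1..n} \<Longrightarrow> \<alpha> k = of_nat (p k)"
    and \<beta>: "\<And>k. k \<in> {1..n} \<Longrightarrow> \<beta> k = of_nat (q k)"
  shows "alg_isomorphic scale UNIV br cscale (coords (n + 2)) (sc_br (n + 2) (ext2 n g \<alpha> \<beta>))"
proof -
  obtain x0 y0 where xy0: "lam x0 = 1" "mu x0 = 0" "lam y0 = 0" "mu y0 = 1"
    by (rule torus_coordinates)
  define h where "h = x0 + scale (of_nat n) y0"
  have h: "lam h = 1" "mu h = of_nat n"
    by (simp_all add: h_def lam_add mu_add lam_scale mu_scale xy0)
  \<comment> \<open>The corrections lie in \<open>N\<close>, where \<open>lam\<close> and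
    \<open>mu\<close> vanish, so the dual pair of values is kept.\<close>
  obtain x1 where x1: "x1 \<in> N" "br (x0 - x1) h = 0" using commuting_representative[OF h] by blast
  obtain y1 where y1: "y1 \<in> N" "br (y0 - y1) h = 0" using commuting_representative[OF h] by blast
  define x where "x = x0 - x1"
  define y where "y = y0 - y1"
  have xy: "lam x = 1" "mu x = 0" "lam y = 0" "mu y = 1" "br x h = 0" "br y h = 0"
    using x1 y1 by (simp_all add: x_def y_def lam_diff mu_diff lam_N mu_N xy0)
  have torus: "br x y = 0" "br y x = 0" "br x x = 0" "br y y = 0"
    using torus_commutes[OF h] xy by auto
  have "\<forall>k\<in>I. \<exists>b. b \<in> N \<and> br b h = scale (of_nat (rk k)) b \<and> \<phi> b k = 1 \<and>
      (\<forall>j\<in>I. rk j < rk k \<longrightarrow> \<phi> b j = 0)"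
    using eigenvector[OF h] by blast
  from bchoice[OF this] obtain b where b0: "\<forall>k\<in>I. b k \<in> N \<and> br (b k) h = scale (of_nat (rk k)) (b k) \<and>
      \<phi> (b k) k = 1 \<and> (\<forall>j\<in>I. rk j < rk k \<longrightarrow> \<phi> (b k) j = 0)" ..
  then have b: "\<And>k. k \<in> I \<Longrightarrow> b k \<in> N"
      "\<And>k. k \<in> I \<Longrightarrow> br (b k) h = scale (of_nat (rk k)) (b k)"
      "\<And>k. k \<in> I \<Longrightarrow> \<phi> (b k) k = 1"
      "\<And>j k. \<lbrakk>k \<in> I; j \<in> I; rk j < rk k\<rbrakk> \<Longrightarrow> \<phi> (b k) j = 0"
    by auto
  have bx: "br (b k) x = scale (\<alpha> k) (b k)" and yb: "br (b k) y = scale (\<beta> k) (b k)" if "k \<in> I" for k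
    using torus_eigenvector[OF h b(1)[OF that] b(2)[OF that] b(3)[OF that] b(4)[OF that] that] xy that
    by (simp_all add: \<alpha> \<beta>)
  have xb: "br x (b k) = scale (- \<alpha> k) (b k)" and byk: "br y (b k) = scale (- \<beta> k) (b k)" if "k \<in> I" for k
    using br_antisym[OF h, of x "b k"] br_antisym[OF h, of y "b k"] bx[OF that] yb[OF that]
    by simp_all
  \<comment> \<open>Both sides are eigenvectors for the weight \<open>rk i + rk j\<close>, the right
    one by homogeneity of \<open>g\<close>, so only the coordinate of that weight has to be
    compared.\<close>
  have bb: "br (b i) (b j) = (\<Sum>k\<in>I. scale (g i j k) (b k))" if ij: "i \<in> I" "j \<in> I" for i j
  proof -
    let ?w = "\<Sum>k\<in>I. scale (g i j k) (b k)"
    let ?c = "of_nat (rk i + rk j) :: complex"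
    have wN: "?w \<in> N" and dN: "br (b i) (b j) \<in> N"
      by (simp_all add: N_closed b ij)
    have wh: "br ?w h = scale ?c ?w"
      unfolding br_sum_left scale_sum_right
    proof (rule sum.cong[OF refl])
      fix k assume "k \<in> I"
      then show "br (scale (g i j k) (b k)) h = scale ?c (scale (g i j k) (b k))"
        using homog[of i j k] ij b(2)[of k]
        by (cases "g i j k = 0") (auto simp: br_scale_left mult.commute)
    qed
    have "br (b i) (b j) - ?w = 0"
    proof (rule eigenvector_eq_0[OF h])
      show "br (b i) (b j) - ?w \<in> N" using wN dN by (simp add: N_closed)
      show "br (br (b i) (b j) - ?w) h = scale ?c (br (b i) (b j) - ?w)"
        by (simp add: br_diff_left br_derivation[of "b i" "b j" h] b(2) ij br_scale_left
            br_scale_right wh scale_right_diff_distrib scale_left_distrib)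
      fix k assume k: "k \<in> I" and "of_nat (rk k) = ?c"
      then have rk: "rk k = rk i + rk j" using of_nat_eq_iff by blast
      have "\<phi> (br (b i) (b j)) k = (\<Sum>i'\<in>I. \<Sum>j'\<in>I. \<phi> (b i) i' * \<phi> (b j) j' * g i' j' k)"
        using k ij by (simp add: phi_br b sc_br_def)
      also have "\<dots> = (\<Sum>i'\<in>I. \<Sum>j'\<in>I. if i' = i then if j' = j then g i j k else 0 else 0)"
      proof (intro sum.cong refl)
        fix i' j' assume i': "i' \<in> I" and j': "j' \<in> I"
        show "\<phi> (b i) i' * \<phi> (b j) j' * g i' j' k = (if i' = i then if j' = j then g i j k else 0 else 0)"
        proof (cases "g i' j' k = 0")
          case True
          then show ?thesis by auto
        next
          case False
          then have "rk i' + rk j' = rk i + rk j" using homog[OF i' j' k] rk by simp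
          moreover have "j' = j" if "rk j' = rk j" using that rk_inj j' ij by (auto dest: inj_onD)
          moreover have "i' = i" if "rk i' = rk i" using that rk_inj i' ij by (auto dest: inj_onD)
          \<comment> \<open>With equal sums of weights, any pair other than \<open>(i, j)\<close>
            has one weight strictly below the leading one, where the corresponding factor
            vanishes.\<close>
          ultimately have "i' = i \<and> j' = j \<or> rk i' < rk i \<or> rk j' < rk j"
            by linarith
          then consider "i' = i" "j' = j" | "rk i' < rk i" | "rk j' < rk j" by blast
          then show ?thesis by cases (use b(4)[OF ij(1) i'] b(4)[OF ij(2) j'] b(3) ij in auto)
        qed
      qed
      also have "\<dots> = (\<Sum>i'\<in>I. if i' = i then g i j k else 0)"
        by (rule sum.cong[OF refl]) (use ij in auto)
      also have "\<dots> = g i j k" using ij by simp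
      finally have 1: "\<phi> (br (b i) (b j)) k = g i j k" .
      have "\<phi> ?w k = (\<Sum>k'\<in>I. g i j k' * \<phi> (b k') k)"
        by (simp add: phi_sum_apply N_closed b phi_scale_apply)
      also have "\<dots> = (\<Sum>k'\<in>I. if k' = k then g i j k else 0)"
      proof (rule sum.cong[OF refl])
        fix k' assume k': "k' \<in> I"
        show "g i j k' * \<phi> (b k') k = (if k' = k then g i j k else 0)"
        proof (cases "g i j k' = 0")
          case False
          then have "rk k' = rk k" using homog[OF ij k'] rk by simp
          then have "k' = k" by (rule inj_onD[OF rk_inj _ k' k])
          then show ?thesis using b(3)[OF k] by simp
        qed auto
      qed
      also have "\<dots> = g i j k" using k by simp
      finally show "\<phi> (br (b i) (b j) - ?w) k = 0" using 1 wN dN by (simp add: phi_simps)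
    qed
    then show ?thesis by simp
  qed
  have split: "k \<in> I \<or> k = n + 1 \<or> k = n + 2" if "k \<in> {1..n + 2}" for k
    using that by (auto simp: atLeastAtMost_iff)
  define B where "B k = (if k \<le> n then b k else if k = n + 1 then x else y)" for k
  have sum_split: "(\<Sum>k\<in>{1..n + 2}. scale (a k) (B k))
      = (\<Sum>k\<in>I. scale (a k) (b k)) + scale (a (n + 1)) x + scale (a (n + 2)) y" for a
  proof -
    have "(\<Sum>k\<in>I. scale (a k) (B k)) = (\<Sum>k\<in>I. scale (a k) (b k))"
      by (rule sum.cong) (auto simp: B_def atLeastAtMost_iff)
    moreover have "{1..n + 2} = insert (n + 2) (insert (n + 1) I)" "n + 1 \<notin> I" "n + 2 \<notin> insert (n + 1) I"
      by (auto simp: atLeastAtMost_iff)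
    ultimately show ?thesis by (simp add: B_def add_ac)
  qed
  show ?thesis
  proof (rule alg_isomorphic_of_basis[where d = "n + 2" and B = B])
    fix a assume "(\<Sum>k\<in>{1..n + 2}. scale (a k) (B k)) = 0"
    then have z: "(\<Sum>k\<in>I. scale (a k) (b k)) + scale (a (n + 1)) x + scale (a (n + 2)) y = 0"
      by (simp only: sum_split)
    have wN: "(\<Sum>k\<in>I. scale (a k) (b k)) \<in> N" by (simp add: N_closed b)
    \<comment> \<open>\<open>lam\<close> and \<open>mu\<close> vanish on \<open>N\<close> and are
      dual to \<open>x\<close> and \<open>y\<close>, so they extract the last two
      coefficients.\<close>
    have a1: "a (n + 1) = 0"
      using arg_cong[OF z, of lam] wN lam_N[OF subspace_0[OF N_subspace]]
      by (simp add: lam_add lam_scale lam_N xy)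
    have a2: "a (n + 2) = 0"
      using arg_cong[OF z, of mu] wN mu_N[OF subspace_0[OF N_subspace]]
      by (simp add: mu_add mu_scale mu_N xy)
    have "\<forall>k\<in>I. a k = 0"
      using triangular_basis_independent[of b a] b z a1 a2 by simp
    with a1 a2 show "\<forall>k\<in>{1..n + 2}. a k = 0" using split by blast
  next
    fix u
    have "u - scale (lam u) x - scale (mu u) y \<in> N"
      by (rule kernel_in_N) (simp_all add: lam_diff mu_diff lam_scale mu_scale xy)
    then obtain a where a: "u - scale (lam u) x - scale (mu u) y = (\<Sum>k\<in>I. scale (a k) (b k))"
      using triangular_basis_spanning[of b] b by blast
    let ?a = "\<lambda>k. if k \<le> n then a k else if k = n + 1 then lam u else mu u"
    have "(\<Sum>k\<in>I. scale (?a k) (b k)) = (\<Sum>k\<in>I. scale (a k) (b k))"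
      by (rule sum.cong) (auto simp: atLeastAtMost_iff)
    then have "u = (\<Sum>k\<in>{1..n + 2}. scale (?a k) (B k))"
      unfolding sum_split by (simp add: a[symmetric])
    then show "\<exists>a. u = (\<Sum>k\<in>{1..n + 2}. scale (a k) (B k))"
      by (rule exI[of _ ?a])
  next
    fix i j assume ij: "i \<in> {1..n + 2}" "j \<in> {1..n + 2}"
    \<comment> \<open>\<open>ext2\<close> evaluates \<open>g\<close> also at the two new target
      indices.\<close>
    have out: "g i j (n + 1) = 0" "g i j (n + 2) = 0" if "i \<in> I" "j \<in> I"
    proof -
      have "n + 1 \<notin> I" "n + 2 \<notin> I" by (auto simp: atLeastAtMost_iff)
      then show "g i j (n + 1) = 0" "g i j (n + 2) = 0" using closed[OF that] by blast+
    qed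
    have Bk: "B k = b k" "1 \<le> k \<and> k \<le> n" "k \<noteq> n + 1" "k \<noteq> n + 2" if "k \<in> I" for k
      using that by (auto simp: B_def atLeastAtMost_iff)
    have delta: "(\<Sum>k\<in>I. scale (if k = j then c else 0) (b k)) = scale c (b j)" if "j \<in> I" for c j
    proof -
      have "(\<Sum>k\<in>I. scale (if k = j then c else 0) (b k)) = (\<Sum>k\<in>I. if k = j then scale c (b j) else 0)"
        by (rule sum.cong) auto
      then show ?thesis using that by simp
    qed
    consider (nn) "i \<in> I" "j \<in> I" | (nt) "i \<in> I" "j \<notin> I" | (tn) "i \<notin> I" "j \<in> I" | (tt) "i \<notin> I" "j \<notin> I"
      by blast
    then show "br (B i) (B j) = (\<Sum>k\<in>{1..n + 2}. scale (ext2 n g \<alpha> \<beta> i j k) (B k))"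
    proof cases
      case nn
      then show ?thesis
        unfolding sum_split using out[OF nn] Bk[OF nn(1)] Bk[OF nn(2)]
        by (simp add: ext2_def bb)
    next
      case nt
      then show ?thesis
        unfolding sum_split using split[OF ij(2)] Bk[OF nt(1)] delta[OF nt(1)]
        by (auto simp: ext2_def B_def bx yb)
    next
      case tn
      then show ?thesis
        unfolding sum_split using split[OF ij(1)] Bk[OF tn(2)] delta[OF tn(2)]
        by (auto simp: ext2_def B_def xb byk)
    next
      case tt
      then show ?thesis
        unfolding sum_split using split[OF ij(1)] split[OF ij(2)]
        by (auto simp: ext2_def B_def torus)
    qed
  qed
qed

end

section \<open>Coordinate formulas for the two brackets\<close>

lemma sum_sum_delta:
  fixes u v :: "nat \<Rightarrow> complex"
  assumes "finite A" "a \<in> A" "b \<in> A"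
  shows "(\<Sum>i\<in>A. \<Sum>j\<in>A. u i * v j * (if i = a \<and> j = b then c else 0)) = u a * v b * c"
proof -
  have "(\<Sum>i\<in>A. \<Sum>j\<in>A. u i * v j * (if i = a \<and> j = b then c else 0))
      = (\<Sum>i\<in>A. if i = a then \<Sum>j\<in>A. if j = b then u a * v b * c else 0 else 0)"
    by (intro sum.cong refl) (auto intro: sum.cong)
  then show ?thesis using assms by simp
qed

text \<open>As \<open>n\<close> is odd, \<open>i\<close> and \<open>n - i\<close> have opposite
  parity, so the sign rule (-1)^i, stated for the first half of the indices, holds on all of
  \<open>{2..n - 2}\<close>.\<close>

lemma g1_apply:
  assumes "odd n" "n > 5" "i \<in> {1..n}" "j \<in> {1..n}"
  shows "g1 n i j k =
    (if k \<in> {3..n - 1} then (if i = 1 \<and> j = k - 1 then 1 else 0) - (if i = k - 1 \<and> j = 1 then 1 else 0)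
     else if k = n then (if i \<in> {2..n - 2} then if j = n - i then (-1) ^ i else 0 else 0)
     else 0)"
proof (cases "k = n")
  case True
  obtain m where m: "n = 2 * m + 1" using assms(1) by (elim oddE)
  have n0: "\<not> (j \<le> n - 2 \<and> n = j + 1)" "\<not> (i \<le> n - 2 \<and> n = i + 1)" using assms by auto
  have g: "g1 n i j n = (if 2 \<le> i \<and> i \<le> m \<and> j = n - i then (-1) ^ i else 0)
      + (if 2 \<le> j \<and> j \<le> m \<and> i = n - j then - ((-1) ^ j) else 0)"
    unfolding g1_def using n0 m by auto
  consider "j \<noteq> n - i \<or> i \<notin> {2..n - 2}" | "j = n - i" "2 \<le> i" "i \<le> m"
    | "j = n - i" "i \<le> n - 2" "m < i"
    by force
  then have "g1 n i j n = (if i \<in> {2..n - 2} then if j = n - i then (-1) ^ i else 0 else 0)"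
  proof cases
    case 1
    then have "\<not> (2 \<le> i \<and> i \<le> m \<and> j = n - i)" "\<not> (2 \<le> j \<and> j \<le> m \<and> i = n - j)"
      using assms m by auto
    then show ?thesis unfolding g using 1 by auto
  next
    case 2
    then have "\<not> j \<le> m" "i \<in> {2..n - 2}" using m assms by auto
    then show ?thesis unfolding g using 2 by simp
  next
    case 3
    have "even (i + j + 1)" using 3 assms by simp
    then have "(-1) ^ i = - ((-1 :: complex) ^ j)"
      by (cases "even i") auto
    moreover have c1: "\<not> (2 \<le> i \<and> i \<le> m \<and> j = n - i)" and c2: "2 \<le> j \<and> j \<le> m \<and> i = n - j"
      and mem: "i \<in> {2..n - 2}"
      using 3 m assms by auto
    ultimately show ?thesis
      unfolding g if_not_P[OF c1] if_P[OF c2] if_P[OF mem] if_P[OF 3(1)] by simp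
  qed
  then show ?thesis using True by auto
next
  case False
  then show ?thesis using assms by (auto simp: g1_def)
qed

lemma sc_br_g1:
  assumes "odd n" "n > 5"
  shows "sc_br n (g1 n) u v k =
    (if k \<in> {3..n - 1} then u 1 * v (k - 1) - u (k - 1) * v 1
     else if k = n then \<Sum>i\<in>{2..n - 2}. (-1) ^ i * u i * v (n - i)
     else 0)"
proof -
  let ?I = "{1..n}"
  have *: "sc_br n (g1 n) u v k = (if k \<in> ?I then \<Sum>i\<in>?I. \<Sum>j\<in>?I. u i * v j *
    (if k \<in> {3..n - 1} then (if i = 1 \<and> j = k - 1 then 1 else 0) - (if i = k - 1 \<and> j = 1 then 1 else 0)
     else if k = n then (if i \<in> {2..n - 2} then if j = n - i then (-1) ^ i else 0 else 0)
     else 0) else 0)"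
    unfolding sc_br_def using g1_apply[OF assms] by (intro if_cong sum.cong refl) auto
  show ?thesis
  proof (cases "k \<in> {3..n - 1}")
    case True
    then have "k \<in> ?I" "1 \<in> ?I" "k - 1 \<in> ?I" using assms by auto
    then show ?thesis unfolding * using True
      by (simp only: if_True right_diff_distrib sum_subtractf sum_sum_delta finite_atLeastAtMost mult_1_right)
  next
    case False
    show ?thesis
    proof (cases "k = n")
      case True
      have "sc_br n (g1 n) u v k
          = (\<Sum>i\<in>?I. if i \<in> {2..n - 2} then (-1) ^ i * u i * v (n - i) else 0)"
      proof -
        have "(\<Sum>j\<in>?I. u i * v j * (if i \<in> {2..n - 2} then if j = n - i then (-1) ^ i else 0 else 0))
            = (if i \<in> {2..n - 2} then (-1) ^ i * u i * v (n - i) else 0)" if "i \<in> ?I" for i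
        proof (cases "i \<in> {2..n - 2}")
          case True
          have "(\<Sum>j\<in>?I. u i * v j * (if j = n - i then (-1) ^ i else 0))
              = (\<Sum>j\<in>?I. if j = n - i then (-1) ^ i * u i * v (n - i) else 0)"
            by (rule sum.cong) auto
          moreover have "n - i \<in> ?I" using True assms by auto
          ultimately show ?thesis using True by simp
        next
          case False
          show ?thesis unfolding if_not_P[OF False] by simp
        qed
        then show ?thesis unfolding * using True False assms by simp
      qed
      also have "\<dots> = (\<Sum>i\<in>{2..n - 2}. (-1) ^ i * u i * v (n - i))"
        by (subst sum.inter_filter[symmetric]) (auto intro!: sum.cong)
      finally show ?thesis unfolding if_not_P[OF False] if_P[OF True] .
    next
      case False
      show ?thesis unfolding * if_not_P[OF \<open>k \<notin> {3..n - 1}\<close>] if_not_P[OF False] by simp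
    qed
  qed
qed

text \<open>The guard \<open>k \<ge> 4\<close> expresses that the source index \<open>k - 2\<close>
  is at least 2.\<close>

lemma g2_apply:
  assumes "n > 5" "i \<in> {1..n}" "j \<in> {1..n}"
  shows "g2 n i j k =
    (if k \<in> {3..n - 1} then (if i = 1 \<and> j = k - 1 then 1 else 0) - (if i = k - 1 \<and> j = 1 then 1 else 0)
       + (if k \<ge> 4 then (if i = k - 2 \<and> j = n then 1 else 0) - (if i = n \<and> j = k - 2 then 1 else 0) else 0)
     else 0)"
proof -
  have c: "i = 1 \<and> 2 \<le> j \<and> j \<le> n - 2 \<and> k = j + 1 \<longleftrightarrow> k \<in> {3..n - 1} \<and> i = 1 \<and> j = k - 1"
    "j = 1 \<and> 2 \<le> i \<and> i \<le> n - 2 \<and> k = i + 1 \<longleftrightarrow> k \<in> {3..n - 1} \<and> i = k - 1 \<and> j = 1"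
    "2 \<le> i \<and> i \<le> n - 3 \<and> j = n \<and> k = i + 2 \<longleftrightarrow> k \<in> {3..n - 1} \<and> k \<ge> 4 \<and> i = k - 2 \<and> j = n"
    "2 \<le> j \<and> j \<le> n - 3 \<and> i = n \<and> k = j + 2 \<longleftrightarrow> k \<in> {3..n - 1} \<and> k \<ge> 4 \<and> i = n \<and> j = k - 2"
    using assms by auto
  have m: "(if P then - 1 else 0) = - (if P then 1 else 0 :: complex)" for P by simp
  show ?thesis
    unfolding g2_def c m
    by (cases "k \<in> {3..n - 1}"; cases "4 \<le> k";
        simp only: simp_thms if_True if_False minus_zero add_0_right add_uminus_conv_diff add_diff_eq)
qed

lemma sc_br_g2:
  assumes "n > 5"
  shows "sc_br n (g2 n) u v k =
    (if k \<in> {3..n - 1} then u 1 * v (k - 1) - u (k - 1) * v 1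
       + (if k \<ge> 4 then u (k - 2) * v n - u n * v (k - 2) else 0)
     else 0)"
proof -
  let ?I = "{1..n}"
  have *: "sc_br n (g2 n) u v k = (if k \<in> ?I then \<Sum>i\<in>?I. \<Sum>j\<in>?I. u i * v j *
    (if k \<in> {3..n - 1} then (if i = 1 \<and> j = k - 1 then 1 else 0) - (if i = k - 1 \<and> j = 1 then 1 else 0)
       + (if k \<ge> 4 then (if i = k - 2 \<and> j = n then 1 else 0) - (if i = n \<and> j = k - 2 then 1 else 0) else 0)
     else 0) else 0)"
    unfolding sc_br_def using g2_apply[OF assms] by (intro if_cong sum.cong refl) auto
  show ?thesis
  proof (cases "k \<in> {3..n - 1}")
    case True
    then have mem: "k \<in> ?I" "1 \<in> ?I" "k - 1 \<in> ?I" "n \<in> ?I" using assms by auto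
    show ?thesis
    proof (cases "k \<ge> 4")
      case True
      then have "k - 2 \<in> ?I" using mem by auto
      then show ?thesis unfolding * using True \<open>k \<in> {3..n - 1}\<close> mem
        by (simp only: if_True right_diff_distrib distrib_left sum_subtractf sum.distrib sum_sum_delta
            finite_atLeastAtMost mult_1_right)
    next
      case False
      then show ?thesis unfolding * using \<open>k \<in> {3..n - 1}\<close> mem
        by (simp only: if_True if_False add_0_right right_diff_distrib sum_subtractf sum_sum_delta
            finite_atLeastAtMost mult_1_right)
    qed
  next
    case False
    show ?thesis unfolding * if_not_P[OF False] by simp
  qed
qed

section \<open>Derivations and centre of g^1\<close>

text \<open>With \<open>q1\<close>, the bidegrees forced by giving e_1 degree (1, 0) and e_2 degree
  (0, 1): e_k arises from e_2 by k - 2 brackets with e_1, and e_n = [e_2, e_(n-2)] has degree (n -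
  4, 2).\<close>

definition p1 :: "nat \<Rightarrow> nat \<Rightarrow> nat" where
  "p1 n k = (if k = 1 then 1 else if k = n then n - 4 else k - 2)"

definition q1 :: "nat \<Rightarrow> nat \<Rightarrow> nat" where
  "q1 n k = (if k = 1 then 0 else if k = n then 2 else 1)"

lemma sum_delta_left:
  fixes v :: "nat \<Rightarrow> complex"
  shows "(\<Sum>i\<in>{2..r}. (-1) ^ i * (if i = a then 1 else 0) * v i)
    = (if a \<in> {2..r} then (-1) ^ a * v a else 0)"
proof -
  have "(\<Sum>i\<in>{2..r}. (-1) ^ i * (if i = a then 1 else 0) * v i)
      = (\<Sum>i\<in>{2..r}. if i = a then (-1) ^ a * v a else 0)"
    by (rule sum.cong) auto
  then show ?thesis by simp
qed

lemma sum_delta_right: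
  fixes u :: "nat \<Rightarrow> complex"
  assumes "a \<le> n"
  shows "(\<Sum>i\<in>{2..n - 2}. (-1) ^ i * u i * (if n - i = a then 1 else 0))
    = (if n - a \<in> {2..n - 2} then (-1) ^ (n - a) * u (n - a) else 0)"
proof -
  have "(\<Sum>i\<in>{2..n - 2}. (-1) ^ i * u i * (if n - i = a then 1 else 0))
      = (\<Sum>i\<in>{2..n - 2}. if i = n - a then (-1) ^ (n - a) * u (n - a) else 0)"
    by (rule sum.cong) (use assms in auto)
  then show ?thesis by simp
qed

context
  fixes n :: nat
  assumes n: "n > 5" "odd n"
begin

lemma n_ge_7: "n \<ge> 7"
proof -
  have "n \<noteq> 6" using n by auto
  then show ?thesis using n by simp
qed

lemma sc_br_g1_less:
  "k \<le> n - 1 \<Longrightarrow> sc_br n (g1 n) u v k = (if 3 \<le> k then u 1 * v (k - 1) - u (k - 1) * v 1 else 0)"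
  using n by (subst sc_br_g1) auto

lemma g1_e1_ei: "i \<in> {2..n - 2} \<Longrightarrow> sc_br n (g1 n) (unit_vec 1) (unit_vec i) = unit_vec (i + 1)"
  by (rule ext) (use n in \<open>auto simp: sc_br_g1 sum_delta_left\<close>)

lemma g1_e2_en: "sc_br n (g1 n) (unit_vec 2) (unit_vec (n - 2)) = unit_vec n"
  by (rule ext) (use n in \<open>auto simp: sc_br_g1 sum_delta_left\<close>)

text \<open>For \<open>n = 5\<close> this bracket would be e_5; parity and \<open>n > 5\<close> give
  \<open>n \<ge> 7\<close>.\<close>

lemma g1_e2_e3: "sc_br n (g1 n) (unit_vec 2) (unit_vec 3) = 0"
  by (rule ext) (use n n_ge_7 in \<open>auto simp: sc_br_g1 sum_delta_left\<close>)

context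
  fixes D
  assumes D: "is_derivation n (g1 n) D"
begin

lemmas D_unit = derivation_unit_vec[OF D]

lemma g1_derivation_step:
  assumes "i \<in> {2..n - 2}" "k \<le> n - 1"
  shows "matrix_of D (i + 1) k =
    (if 3 \<le> k then (if k = i + 1 then matrix_of D 1 1 else 0) + matrix_of D i (k - 1) else 0)"
proof -
  have i: "i \<in> {1..n}" "1 \<in> {1..n}" using assms n by auto
  show ?thesis
    using D_unit(1)[OF i(2) i(1) g1_e1_ei[OF assms(1)], of k] assms n
    by (simp add: sc_br_g1_less) (auto simp: le_Suc_eq)
qed

lemma g1_derivation_21: "matrix_of D 2 1 = 0"
proof -
  have mem: "2 \<in> {1..n}" "3 \<in> {1..n}" using n by auto
  show ?thesis
    using D_unit(2)[OF mem g1_e2_e3, of 4] n_ge_7 by (simp add: sc_br_g1_less)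
qed

text \<open>Along the chain e_(i+1) = [e_1, e_i] each row of the matrix is the previous one shifted
  by one place, with \<open>matrix_of D 1 1\<close> added on the diagonal. The offset 2 starts the
  chain at e_2.\<close>

lemma g1_derivation_lower:
  assumes "i + 2 \<le> n - 1"
  shows "matrix_of D (i + 2) (i + 2) = of_nat i * matrix_of D 1 1 + matrix_of D 2 2
    \<and> (\<forall>k. 1 \<le> k \<longrightarrow> k < i + 2 \<longrightarrow> matrix_of D (i + 2) k = 0)"
  using assms
proof (induction i)
  case 0
  have "k = 1" if "1 \<le> k" "k < 2" for k :: nat using that by simp
  then have "\<forall>k. 1 \<le> k \<longrightarrow> k < 2 \<longrightarrow> matrix_of D 2 k = 0"
    using g1_derivation_21 by blast
  then show ?case by (simp only: add_0 of_nat_0 mult_zero_left simp_thms)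
next
  case (Suc i)
  have mem: "i + 2 \<in> {2..n - 2}" using Suc.prems by simp
  have step: "matrix_of D (Suc i + 2) k =
    (if 3 \<le> k then (if k = Suc i + 2 then matrix_of D 1 1 else 0) + matrix_of D (i + 2) (k - 1) else 0)"
    if "k \<le> n - 1" for k
    using g1_derivation_step[OF mem that] by simp
  have IH: "matrix_of D (i + 2) (i + 2) = of_nat i * matrix_of D 1 1 + matrix_of D 2 2"
      "\<And>k. 1 \<le> k \<Longrightarrow> k < i + 2 \<Longrightarrow> matrix_of D (i + 2) k = 0"
    using Suc by auto
  have "matrix_of D (Suc i + 2) (Suc i + 2) = matrix_of D 1 1 + matrix_of D (i + 2) (i + 2)"
    using step[of "Suc i + 2"] Suc.prems by simp
  moreover have "matrix_of D (Suc i + 2) k = 0" if "1 \<le> k" "k < Suc i + 2" for k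
    using step[of k] IH(2)[of "k - 1"] that Suc.prems by auto
  ultimately show ?case using IH(1) by (auto simp: algebra_simps)
qed

lemma g1_derivation_mid:
  assumes "2 \<le> j" "j \<le> n - 1"
  shows "matrix_of D j j = of_nat (j - 2) * matrix_of D 1 1 + matrix_of D 2 2"
    and "1 \<le> k \<Longrightarrow> k < j \<Longrightarrow> matrix_of D j k = 0"
proof -
  obtain i where "j = i + 2" using assms le_Suc_ex by (metis add.commute)
  then show "matrix_of D j j = of_nat (j - 2) * matrix_of D 1 1 + matrix_of D 2 2"
    and "1 \<le> k \<Longrightarrow> k < j \<Longrightarrow> matrix_of D j k = 0"
    using g1_derivation_lower[of i] assms(2) by simp_all
qed

text \<open>Product rule for e_n = [e_2, e_(n-2)]. Neither D e_2 nor D e_(n-2) has an e_1 component,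
  so only multiples of e_n survive.\<close>

lemma g1_derivation_n:
  assumes "k \<in> {1..n}"
  shows "matrix_of D n k =
    (if k = n then (of_nat n - 4) * matrix_of D 1 1 + 2 * matrix_of D 2 2 else 0)"
proof -
  have mem: "2 \<in> {1..n}" "n - 2 \<in> {1..n}" using n by auto
  have low: "matrix_of D (n - 2) (n - 2) = of_nat (n - 4) * matrix_of D 1 1 + matrix_of D 2 2"
    "matrix_of D (n - 2) 1 = 0"
    using g1_derivation_mid(1)[of "n - 2"] g1_derivation_mid(2)[of "n - 2" 1] n by simp_all
  have "sc_br n (g1 n) (unit_vec 2) (matrix_of D (n - 2)) k = (if k = n then matrix_of D (n - 2) (n - 2) else 0)"
    unfolding sc_br_g1[OF n(2,1)] using low(2) n assms by (auto simp: sum_delta_left)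
  moreover have "sc_br n (g1 n) (matrix_of D 2) (unit_vec (n - 2)) k = (if k = n then matrix_of D 2 2 else 0)"
    unfolding sc_br_g1[OF n(2,1)] using g1_derivation_21 n assms by (auto simp: sum_delta_right)
  ultimately show ?thesis
    using D_unit(1)[OF mem g1_e2_en, of k] low(1) n by (simp add: of_nat_diff algebra_simps)
qed

end

lemma g1_nonzero:
  assumes "g1 n i j k \<noteq> 0"
  shows "i = 1 \<and> 2 \<le> j \<and> j \<le> n - 2 \<and> k = j + 1 \<or> j = 1 \<and> 2 \<le> i \<and> i \<le> n - 2 \<and> k = i + 1
    \<or> 2 \<le> i \<and> i \<le> (n - 1) div 2 \<and> j = n - i \<and> k = n
    \<or> 2 \<le> j \<and> j \<le> (n - 1) div 2 \<and> i = n - j \<and> k = n" (is "?A \<or> ?B \<or> ?C \<or> ?D")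
proof (rule ccontr)
  assume "\<not> (?A \<or> ?B \<or> ?C \<or> ?D)"
  then have A: "\<not> ?A" and B: "\<not> ?B" and C: "\<not> ?C" and D: "\<not> ?D" by blast+
  show False
    using assms unfolding g1_def if_not_P[OF A] if_not_P[OF B] if_not_P[OF C] if_not_P[OF D] by simp
qed

lemma rigid_g1: "rigid_nilradical n (g1 n) (p1 n) (q1 n) 1 2"
proof
  have m: "(if P then - c else 0) = - (if P then c else 0 :: complex)" for P c by simp
  show "g1 n i j k = - g1 n j i k" for i j k
    unfolding g1_def m by (simp only: minus_add_distrib minus_minus ac_simps)
  show k: "k \<in> {1..n}" if "i \<in> {1..n}" "j \<in> {1..n}" "g1 n i j k \<noteq> 0" for i j k
    using g1_nonzero[OF that(3)] that n by auto
  show "p1 n k + n * q1 n k = (p1 n i + n * q1 n i) + (p1 n j + n * q1 n j)"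
    if "i \<in> {1..n}" "j \<in> {1..n}" "k \<in> {1..n}" "g1 n i j k \<noteq> 0" for i j k
    using g1_nonzero[OF that(4)] n by (elim disjE) (auto simp: p1_def q1_def)
  show "inj_on (\<lambda>k. p1 n k + n * q1 n k) {1..n}"
    using n by (auto simp: inj_on_def p1_def q1_def split: if_splits)
  show "0 < p1 n k + n * q1 n k" for k
    using n by (auto simp: p1_def q1_def)
  show "1 \<in> {1..n}" "p1 n 1 = 1" "q1 n 1 = 0" "2 \<in> {1..n}" "p1 n 2 = 0" "q1 n 2 = 1"
    using n by (auto simp: p1_def q1_def)
  show "\<exists>u\<in>coords n. \<exists>v\<in>coords n. z = sc_br n (g1 n) u v"
    if z: "z \<in> coords n" "\<And>v. v \<in> coords n \<Longrightarrow> sc_br n (g1 n) v z = 0" for z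
  proof -
    have br: "sc_br n (g1 n) (unit_vec i) z k = 0" if "i \<in> {1..n}" for i k
      using z(2)[OF unit_vec_in_coords[OF that]] by simp
    \<comment> \<open>Bracketing with e_1 moves these coordinates up by one; bracketing with e_2
      exposes the first coordinate.\<close>
    have "z k = 0" if "k \<in> {2..n - 2}" for k
      using br[of 1 "k + 1"] sc_br_g1_less[of "k + 1" "unit_vec 1" z] that n by auto
    moreover have "z 1 = 0" using br[of 2 3] n by (simp add: sc_br_g1_less)
    ultimately have z0: "z k = 0" if "k \<in> {1..n - 2}" for k
      using that by (cases "k = 1") auto
    \<comment> \<open>What remains is a combination of e_(n-1) = [e_1, e_(n-2)] and e_n =
      [e_2, e_(n-2)]; the common right factor makes it a single bracket.\<close>
    define u where "u = (\<lambda>k. z (n - 1) * unit_vec 1 k + z n * unit_vec 2 k)"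
    have u: "u \<in> coords n" using n by (auto simp: u_def coords_def)
    have v: "unit_vec (n - 2) \<in> coords n" using n by (intro unit_vec_in_coords) auto
    have "z k = sc_br n (g1 n) u (unit_vec (n - 2)) k" if k: "k \<in> {1..n}" for k
    proof -
      consider "k \<in> {1..n - 2}" | "k = n - 1" | "k = n" using k by force
      then show ?thesis
      proof cases
        case 1
        then show ?thesis using z0[of k] n by (auto simp: sc_br_g1_less)
      next
        case 2
        then show ?thesis using n by (auto simp: sc_br_g1_less u_def)
      next
        case 3
        have "sc_br n (g1 n) u (unit_vec (n - 2)) n = u 2"
          using n by (auto simp: sc_br_g1 sum_delta_right)
        then show ?thesis using 3 by (simp add: u_def)
      qed
    qed
    then have "z = sc_br n (g1 n) u (unit_vec (n - 2))"
      by (intro coords_eqI[OF z(1) sc_br_in_coords])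
    then show ?thesis using u v by blast
  qed
  fix D j k
  assume D: "is_derivation n (g1 n) D"
  {
    assume jk: "j \<in> {1..n}" "k \<in> {1..n}" "p1 n k + n * q1 n k < p1 n j + n * q1 n j"
    \<comment> \<open>For g^1 the weight order is the order of the indices.\<close>
    then have "k < j" and j: "j \<noteq> 1"
      using n by (auto simp: p1_def q1_def split: if_splits)
    then show "matrix_of D j k = 0"
      using g1_derivation_mid(2)[OF D, of j k] g1_derivation_n[OF D, of k] jk
      by (cases "j = n") auto
  }
  {
    assume k: "k \<in> {1..n}"
    consider "k = 1" | "k = n" | "k \<noteq> 1" "k \<noteq> n" "2 \<le> k" "k \<le> n - 1" using k by force
    then show "matrix_of D k k = of_nat (p1 n k) * matrix_of D 1 1 + of_nat (q1 n k) * matrix_of D 2 2"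
    proof cases
      case 1
      then show ?thesis by (simp add: p1_def q1_def)
    next
      case 2
      then show ?thesis using g1_derivation_n[OF D, of n] n by (simp add: p1_def q1_def of_nat_diff)
    next
      case 3
      then show ?thesis using g1_derivation_mid(1)[OF D, of k] by (simp add: p1_def q1_def)
    qed
  }
qed

end

section \<open>Derivations and centre of g^2\<close>

text \<open>The bidegrees of g^2, with e_1 and e_2 of degrees (1, 0) and (0, 1) again; now
  [e_2, e_n] = e_4 forces degree (2, 0) on e_n.\<close>

definition p2 :: "nat \<Rightarrow> nat \<Rightarrow> nat" where
  "p2 n k = (if k = 1 then 1 else if k = n then 2 else k - 2)"

definition q2 :: "nat \<Rightarrow> nat \<Rightarrow> nat" where
  "q2 n k = (if k = 1 then 0 else if k = n then 0 else 1)"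

context
  fixes n :: nat
  assumes n: "n > 5"
begin

lemma sc_br_g2_mid:
  "k \<in> {4..n - 1} \<Longrightarrow> sc_br n (g2 n) u v k =
    u 1 * v (k - 1) - u (k - 1) * v 1 + u (k - 2) * v n - u n * v (k - 2)"
  using n by (simp add: sc_br_g2)

lemma sc_br_g2_3: "sc_br n (g2 n) u v 3 = u 1 * v 2 - u 2 * v 1"
  using n by (subst sc_br_g2) auto

lemma sc_br_g2_outside: "k \<notin> {3..n - 1} \<Longrightarrow> sc_br n (g2 n) u v k = 0"
  unfolding sc_br_g2[OF n] by (rule if_not_P)

lemma g2_e1_ei:
  assumes i: "i \<in> {2..n - 2}"
  shows "sc_br n (g2 n) (unit_vec 1) (unit_vec i) = unit_vec (i + 1)"
proof
  fix k
  consider "k \<in> {4..n - 1}" | "k = 3" | "k \<notin> {3..n - 1}" by force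
  then show "sc_br n (g2 n) (unit_vec 1) (unit_vec i) k = unit_vec (i + 1) k"
    by cases (use i n in \<open>auto simp: sc_br_g2_mid sc_br_g2_3 sc_br_g2_outside\<close>)
qed

lemma g2_e2_en: "sc_br n (g2 n) (unit_vec 2) (unit_vec n) = unit_vec 4"
proof
  fix k
  consider "k \<in> {4..n - 1}" | "k = 3" | "k \<notin> {3..n - 1}" by force
  then show "sc_br n (g2 n) (unit_vec 2) (unit_vec n) k = unit_vec 4 k"
    by cases (use n in \<open>auto simp: sc_br_g2_mid sc_br_g2_3 sc_br_g2_outside\<close>)
qed

lemma g2_e2_e3: "sc_br n (g2 n) (unit_vec 2) (unit_vec 3) = 0"
proof
  fix k
  consider "k \<in> {4..n - 1}" | "k = 3" | "k \<notin> {3..n - 1}" by force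
  then show "sc_br n (g2 n) (unit_vec 2) (unit_vec 3) k = 0 k"
    by cases (use n in \<open>auto simp: sc_br_g2_mid sc_br_g2_3 sc_br_g2_outside\<close>)
qed

context
  fixes D
  assumes D: "is_derivation n (g2 n) D"
begin

lemmas D2_unit = derivation_unit_vec[OF D]

text \<open>Product rule for e_(i+1) = [e_1, e_i]. The new term comes from the e_n component of D
  e_1, since [e_n, e_i] = -e_(i+2).\<close>

lemma g2_derivation_step:
  assumes i: "i \<in> {2..n - 2}"
  shows "k \<in> {4..n - 1} \<Longrightarrow> matrix_of D (i + 1) k = (if k = i + 1 then matrix_of D 1 1 else 0)
      - (if k = i + 2 then matrix_of D 1 n else 0) + matrix_of D i (k - 1)"
    and "matrix_of D (i + 1) 3 = (if i = 2 then matrix_of D 1 1 else 0) + matrix_of D i 2"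
    and "k \<notin> {3..n - 1} \<Longrightarrow> matrix_of D (i + 1) k = 0"
proof -
  have mem: "1 \<in> {1..n}" "i \<in> {1..n}" using i n by auto
  note unit = D2_unit(1)[OF mem g2_e1_ei[OF i]]
  show "matrix_of D (i + 1) k = (if k = i + 1 then matrix_of D 1 1 else 0)
      - (if k = i + 2 then matrix_of D 1 n else 0) + matrix_of D i (k - 1)" if k: "k \<in> {4..n - 1}"
  proof -
    have "unit_vec i (k - 1) = (if k = i + 1 then 1 else 0)" "unit_vec i (k - 2) = (if k = i + 2 then 1 else 0)"
      "unit_vec i 1 = 0" "unit_vec i n = 0"
      "unit_vec 1 1 = 1" "unit_vec 1 (k - 1) = 0" "unit_vec 1 (k - 2) = 0" "unit_vec 1 n = 0"
      using i k n by auto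
    then show ?thesis
      unfolding unit sc_br_g2_mid[OF k] by simp
  qed
  show "matrix_of D (i + 1) 3 = (if i = 2 then matrix_of D 1 1 else 0) + matrix_of D i 2"
    unfolding unit sc_br_g2_3 using i by simp
  show "matrix_of D (i + 1) k = 0" if "k \<notin> {3..n - 1}"
    unfolding unit sc_br_g2_outside[OF that] by simp
qed

text \<open>In D [e_2, e_3] = 0 the coefficients of e_4 and e_5 isolate these entries, because D e_3
  has no e_1 or e_n component.\<close>

lemma g2_derivation_21: "matrix_of D 2 1 = 0" and g2_derivation_2n: "matrix_of D 2 n = 0"
proof -
  have mem: "2 \<in> {1..n}" "3 \<in> {1..n}" "4 \<in> {4..n - 1}" "5 \<in> {4..n - 1}" using n by auto
  note zero = D2_unit(2)[OF mem(1,2) g2_e2_e3]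
  have "matrix_of D 3 n = 0" "matrix_of D 3 1 = 0"
    using g2_derivation_step(3)[of 2] n by simp_all
  then show "matrix_of D 2 1 = 0" "matrix_of D 2 n = 0"
    using zero[of 4] zero[of 5] n by (simp_all add: sc_br_g2_mid)
qed

text \<open>The same chain as for g^1, with column \<open>n\<close> carried along because e_n
  precedes e_2 in the weight order.\<close>

lemma g2_derivation_lower:
  assumes "i + 2 \<le> n - 1"
  shows "matrix_of D (i + 2) (i + 2) = of_nat i * matrix_of D 1 1 + matrix_of D 2 2
    \<and> matrix_of D (i + 2) n = 0
    \<and> (\<forall>k. 1 \<le> k \<longrightarrow> k < i + 2 \<longrightarrow> matrix_of D (i + 2) k = 0)"
  using assms
proof (induction i)
  case 0
  have "k = 1" if "1 \<le> k" "k < 2" for k :: nat using that by simp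
  then have "\<forall>k. 1 \<le> k \<longrightarrow> k < 2 \<longrightarrow> matrix_of D 2 k = 0"
    using g2_derivation_21 by blast
  then show ?case using g2_derivation_2n by (simp only: add_0 of_nat_0 mult_zero_left simp_thms)
next
  case (Suc i)
  have mem: "i + 2 \<in> {2..n - 2}" using Suc.prems by simp
  note step = g2_derivation_step[OF mem]
  have IH: "matrix_of D (i + 2) (i + 2) = of_nat i * matrix_of D 1 1 + matrix_of D 2 2"
      "\<And>k. 1 \<le> k \<Longrightarrow> k < i + 2 \<Longrightarrow> matrix_of D (i + 2) k = 0"
    using Suc by auto
  have "matrix_of D (i + 2 + 1) (i + 2 + 1) = matrix_of D 1 1 + matrix_of D (i + 2) (i + 2)"
  proof (cases "i = 0")
    case True
    then show ?thesis using step(2) by (simp add: numeral_2_eq_2 numeral_3_eq_3)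
  next
    case False
    then have "i + 2 + 1 \<in> {4..n - 1}" using Suc.prems by simp
    from step(1)[OF this] show ?thesis by simp
  qed
  moreover have "matrix_of D (i + 2 + 1) n = 0" using n by (intro step(3)) auto
  moreover have "matrix_of D (i + 2 + 1) k = 0" if k: "1 \<le> k" "k < i + 2 + 1" for k
  proof -
    consider "k \<in> {4..n - 1}" | "k = 3" | "k \<notin> {3..n - 1}" by force
    then show ?thesis
    proof cases
      case 1
      have "matrix_of D (i + 2) (k - 1) = 0" using 1 k by (intro IH(2)) auto
      then show ?thesis using step(1)[OF 1] k by simp
    next
      case 2
      then have "matrix_of D (i + 2) 2 = 0" using k by (intro IH(2)) auto
      then show ?thesis using step(2) 2 k by simp
    next
      case 3
      then show ?thesis by (rule step(3))
    qed
  qed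
  moreover have "Suc i + 2 = i + 2 + 1" by simp
  ultimately show ?case using IH(1) by (simp only: of_nat_Suc) (simp add: algebra_simps)
qed

lemma g2_derivation_mid:
  assumes "2 \<le> j" "j \<le> n - 1"
  shows "matrix_of D j j = of_nat (j - 2) * matrix_of D 1 1 + matrix_of D 2 2"
    and "1 \<le> k \<Longrightarrow> k < j \<or> k = n \<Longrightarrow> matrix_of D j k = 0"
proof -
  obtain i where "j = i + 2" using assms le_Suc_ex by (metis add.commute)
  then show "matrix_of D j j = of_nat (j - 2) * matrix_of D 1 1 + matrix_of D 2 2"
    and "1 \<le> k \<Longrightarrow> k < j \<or> k = n \<Longrightarrow> matrix_of D j k = 0"
    using g2_derivation_lower[of i] assms(2) by auto
qed

text \<open>The coefficients of e_3 and e_4 in the product rule for [e_2, e_n] = e_4; the second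
  makes the weight of e_n the difference of those of e_4 and e_2.\<close>

lemma g2_derivation_n: "matrix_of D n 1 = 0" "matrix_of D n n = 2 * matrix_of D 1 1"
proof -
  have mem: "2 \<in> {1..n}" "n \<in> {1..n}" "4 \<in> {4..n - 1}" using n by auto
  note unit = D2_unit(1)[OF mem(1,2) g2_e2_en]
  show "matrix_of D n 1 = 0"
    using unit[of 3] g2_derivation_mid(2)[of 4 3] n by (simp add: sc_br_g2_3)
  show "matrix_of D n n = 2 * matrix_of D 1 1"
    using unit[of 4] g2_derivation_mid(1)[of 4] g2_derivation_2n n
    by (simp add: sc_br_g2_mid[OF mem(3)])
qed

end

lemma g2_nonzero:
  assumes "g2 n i j k \<noteq> 0"
  shows "i = 1 \<and> 2 \<le> j \<and> j \<le> n - 2 \<and> k = j + 1 \<or> j = 1 \<and> 2 \<le> i \<and> i \<le> n - 2 \<and> k = i + 1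
    \<or> 2 \<le> i \<and> i \<le> n - 3 \<and> j = n \<and> k = i + 2 \<or> 2 \<le> j \<and> j \<le> n - 3 \<and> i = n \<and> k = j + 2" (is "?A \<or> ?B \<or> ?C \<or> ?D")
proof (rule ccontr)
  assume "\<not> (?A \<or> ?B \<or> ?C \<or> ?D)"
  then have A: "\<not> ?A" and B: "\<not> ?B" and C: "\<not> ?C" and D: "\<not> ?D" by blast+
  show False
    using assms unfolding g2_def if_not_P[OF A] if_not_P[OF B] if_not_P[OF C] if_not_P[OF D] by simp
qed

lemma rigid_g2: "rigid_nilradical n (g2 n) (p2 n) (q2 n) 1 2"
proof
  have m: "(if P then - c else 0) = - (if P then c else 0 :: complex)" for P c by simp
  show "g2 n i j k = - g2 n j i k" for i j k
    unfolding g2_def m by (simp only: minus_add_distrib minus_minus ac_simps)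
  show k: "k \<in> {1..n}" if "i \<in> {1..n}" "j \<in> {1..n}" "g2 n i j k \<noteq> 0" for i j k
    using g2_nonzero[OF that(3)] n by auto
  show "p2 n k + n * q2 n k = (p2 n i + n * q2 n i) + (p2 n j + n * q2 n j)"
    if "i \<in> {1..n}" "j \<in> {1..n}" "k \<in> {1..n}" "g2 n i j k \<noteq> 0" for i j k
    using g2_nonzero[OF that(4)] n by (elim disjE) (auto simp: p2_def q2_def)
  show "inj_on (\<lambda>k. p2 n k + n * q2 n k) {1..n}"
    using n by (auto simp: inj_on_def p2_def q2_def split: if_splits)
  show "0 < p2 n k + n * q2 n k" for k
    using n by (auto simp: p2_def q2_def)
  show "1 \<in> {1..n}" "p2 n 1 = 1" "q2 n 1 = 0" "2 \<in> {1..n}" "p2 n 2 = 0" "q2 n 2 = 1"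
    using n by (auto simp: p2_def q2_def)
  show "\<exists>u\<in>coords n. \<exists>v\<in>coords n. z = sc_br n (g2 n) u v"
    if z: "z \<in> coords n" "\<And>v. v \<in> coords n \<Longrightarrow> sc_br n (g2 n) v z = 0" for z
  proof -
    have br: "sc_br n (g2 n) (unit_vec i) z k = 0" if "i \<in> {1..n}" for i k
      using z(2)[OF unit_vec_in_coords[OF that]] by simp
    have z1: "z 1 = 0" using br[of 2 3] n by (simp add: sc_br_g2_3)
    have zn: "z n = 0" using br[of 2 4] n by (simp add: sc_br_g2_mid)
    have z2: "z 2 = 0" using br[of 1 3] n by (simp add: sc_br_g2_3)
    have "z k = 0" if "k \<in> {3..n - 2}" for k
      using br[of 1 "k + 1"] sc_br_g2_mid[of "k + 1" "unit_vec 1" z] zn that n by auto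
    then have z0: "z k = 0" if "k \<in> {1..n}" "k \<noteq> n - 1" for k
      using that z1 zn z2 by (cases "k = 1 \<or> k = 2 \<or> k = n") auto
    \<comment> \<open>Here the centre is spanned by e_(n-1) = [e_1, e_(n-2)] alone.\<close>
    define u where "u = (\<lambda>k. z (n - 1) * unit_vec 1 k)"
    have u: "u \<in> coords n" using n by (auto simp: u_def coords_def)
    have v: "unit_vec (n - 2) \<in> coords n" using n by (intro unit_vec_in_coords) auto
    have "z k = sc_br n (g2 n) u (unit_vec (n - 2)) k" if k: "k \<in> {1..n}" for k
    proof -
      show ?thesis
      proof (cases "k = n - 1")
        case True
        then have "k \<in> {4..n - 1}" using n by simp
        then show ?thesis using True n by (auto simp: sc_br_g2_mid u_def)
      next
        case False
        then have "k - 1 \<noteq> n - 2" "z k = 0" using k n z0 by auto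
        moreover consider "k \<in> {4..n - 1}" | "k = 3" | "k \<notin> {3..n - 1}" by force
        then have "sc_br n (g2 n) u (unit_vec (n - 2)) k = 0"
          by cases (use n \<open>k - 1 \<noteq> n - 2\<close> in \<open>auto simp: sc_br_g2_mid sc_br_g2_3 sc_br_g2_outside u_def\<close>)
        ultimately show ?thesis by simp
      qed
    qed
    then have "z = sc_br n (g2 n) u (unit_vec (n - 2))"
      by (intro coords_eqI[OF z(1) sc_br_in_coords])
    then show ?thesis using u v by blast
  qed
  fix D j k
  assume D: "is_derivation n (g2 n) D"
  {
    assume jk: "j \<in> {1..n}" "k \<in> {1..n}" "p2 n k + n * q2 n k < p2 n j + n * q2 n j"
    \<comment> \<open>The weight order is e_1, e_n, e_2, ..., e_(n-1).\<close>
    then have "j = n \<and> k = 1 \<or> j \<noteq> n \<and> 2 \<le> j \<and> (k < j \<or> k = n)"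
      using n by (auto simp: p2_def q2_def split: if_splits)
    then show "matrix_of D j k = 0"
      using g2_derivation_mid(2)[OF D, of j k] g2_derivation_n(1)[OF D] jk by auto
  }
  {
    assume k: "k \<in> {1..n}"
    consider "k = 1" | "k = n" | "k \<noteq> 1" "k \<noteq> n" "2 \<le> k" "k \<le> n - 1" using k by force
    then show "matrix_of D k k = of_nat (p2 n k) * matrix_of D 1 1 + of_nat (q2 n k) * matrix_of D 2 2"
    proof cases
      case 1
      then show ?thesis by (simp add: p2_def q2_def)
    next
      case 2
      then show ?thesis using g2_derivation_n(2)[OF D] n by (simp add: p2_def q2_def)
    next
      case 3
      then show ?thesis using g2_derivation_mid(1)[OF D, of k] by (simp add: p2_def q2_def)
    qed
  }
qed

end

section \<open>Uniqueness of the extension for both families\<close>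

theorem extension_unique:
  assumes "leibniz_algebra scale br" "vector_space.dim scale (UNIV :: 'v::ab_group_add set) = n + 2"
    "solvable_alg scale br" "is_nilradical scale br N"
    and iso: "alg_isomorphic scale N br cscale (coords n) (sc_br n g)"
    and rigid: "rigid_nilradical n g p q l m"
    and "\<And>k. k \<in> {1..n} \<Longrightarrow> \<alpha> k = of_nat (p k)" "\<And>k. k \<in> {1..n} \<Longrightarrow> \<beta> k = of_nat (q k)"
  shows "alg_isomorphic scale (UNIV :: 'v set) br cscale (coords (n + 2)) (sc_br (n + 2) (ext2 n g \<alpha> \<beta>))"
proof -
  obtain \<phi> where "bij_betw \<phi> N (coords n)" "\<forall>u\<in>N. \<forall>v\<in>N. \<phi> (u + v) = \<phi> u + \<phi> v"
    "\<forall>a. \<forall>u\<in>N. \<phi> (scale a u) = cscale a (\<phi> u)"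
    "\<forall>u\<in>N. \<forall>v\<in>N. \<phi> (br u v) = sc_br n g (\<phi> u) (\<phi> v)"
    using iso unfolding alg_isomorphic_def by blast
  then have "rigid_extension scale br n g p q l m N \<phi>"
    using assms by (intro rigid_extension.intro rigid_extension_axioms.intro leibniz_algebra_imp_leibniz) auto
  then show ?thesis
    using assms by (intro rigid_extension.isomorphic_ext2) auto
qed

theorem theorem3p7:
  fixes n :: nat
    and scale :: "complex \<Rightarrow> 'v::ab_group_add \<Rightarrow> 'v"
    and br :: "'v \<Rightarrow> 'v \<Rightarrow> 'v"
  assumes "n > 5"
    and "leibniz_algebra scale br"
    and "vector_space.dim scale (UNIV :: 'v set) = n + 2"
    and "solvable_alg scale br"
  shows "(odd n \<longrightarrow>
            (\<forall>N. is_nilradical scale br N \<and>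
                 alg_isomorphic scale N br cscale (coords n) (sc_br n (g1 n))
              \<longrightarrow> alg_isomorphic scale UNIV br cscale (coords (n + 2)) (sc_br (n + 2) (R1 n))))
       \<and> (\<forall>N. is_nilradical scale br N \<and>
                 alg_isomorphic scale N br cscale (coords n) (sc_br n (g2 n))
              \<longrightarrow> alg_isomorphic scale UNIV br cscale (coords (n + 2)) (sc_br (n + 2) (R2 n)))"
proof (intro conjI impI allI; elim conjE)
  fix N assume "odd n" and N: "is_nilradical scale br N"
    "alg_isomorphic scale N br cscale (coords n) (sc_br n (g1 n))"
  show "alg_isomorphic scale UNIV br cscale (coords (n + 2)) (sc_br (n + 2) (R1 n))"
    unfolding R1_def
  proof (rule extension_unique[OF assms(2-4) N rigid_g1[OF assms(1) \<open>odd n\<close>]])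
    show "alpha1 n k = of_nat (p1 n k)" "beta1 n k = of_nat (q1 n k)" if "k \<in> {1..n}" for k
      using that assms(1) by (auto simp: alpha1_def beta1_def p1_def q1_def of_nat_diff)
  qed
next
  fix N assume N: "is_nilradical scale br N"
    "alg_isomorphic scale N br cscale (coords n) (sc_br n (g2 n))"
  show "alg_isomorphic scale UNIV br cscale (coords (n + 2)) (sc_br (n + 2) (R2 n))"
    unfolding R2_def
  proof (rule extension_unique[OF assms(2-4) N rigid_g2[OF assms(1)]])
    show "alpha2 n k = of_nat (p2 n k)" "beta2 n k = of_nat (q2 n k)" if "k \<in> {1..n}" for k
      using that assms(1) by (auto simp: alpha2_def beta2_def p2_def q2_def of_nat_diff)
  qed
qed

end
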